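(* Let $n \ge 2$ and let $G(n)$ be one of $GL(n,\mathbb{R})$, $SL(n,\mathbb{R})$, $|SL(n,\mathbb{R})| = \{A \in GL(n,\mathbb{R}) : |\det A| = 1\}$, $GL^{+}(n,\mathbb{R}) = \{A \in GL(n,\mathbb{R}) : \det A > 0\}$. If $L$ is a Polish group and $\varphi : L \to \mathbb{R}^n \rtimes G(n)$ is an algebraic isomorphism, then $\varphi^{-1}(SO(n,\mathbb{R}))$ is an analytic subgroup of $L$.
   Context: A Polish group is a topological group whose topology is separable and completely metrizable. An algebraic isomorphism is an isomorphism of abstract groups (no continuity assumed). The natural semidirect product $\mathbb{R}^n \rtimes G(n)$ is the set $\mathbb{R}^n \times G(n)$ with multiplication $(x,A)(y,B) = (x + Ay, AB)$ and the product of the usual topologies. A subset $S \subseteq G(n)$ is identified with $\{(0,A) : A \in S\} \subseteq \mathbb{R}^n \rtimes G(n)$; in particular $SO(n,\mathbb{R})$ is identified with $\{(0,A) : A \in SO(n,\mathbb{R})\}$. An analytic subgroup is a subgroup that is an analytic set in the sense of descriptive set theory (empty or a continuous image of a Polish space). *)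

theory Defs
  imports "HOL-Analysis.Analysis" "HOL-Algebra.Group"
begin

definition polish_topology :: "'a topology \<Rightarrow> bool" where
  "polish_topology X \<longleftrightarrow> completely_metrizable_space X \<and> separable_space X"

text \<open>
  HOL cannot quantify over all Polish spaces of all types. Every Polish space has at most
  continuum many points, so up to homeomorphism it lives on a subset of \<open>nat \<Rightarrow> real\<close>
  (the topology is arbitrary, not the one induced by the product topology).
  Lemma \<open>analytic_inI\<close> below shows that nothing is lost by this choice.
\<close>

definition analytic_in :: "'a topology \<Rightarrow> 'a set \<Rightarrow> bool" where
  "analytic_in T S \<longleftrightarrow> S = {} \<or>
    (\<exists>(X :: (nat \<Rightarrow> real) topology) f.
       polish_topology X \<and> continuous_map X T f \<and> f ` topspace X = S)"

lemma polish_topology_homeomorphic: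
  assumes "X homeomorphic_space Y" "polish_topology X"
  shows "polish_topology Y"
  using assms homeomorphic_completely_metrizable_space homeomorphic_separable_space
  unfolding polish_topology_def by blast

lemma polish_topology_embedding:
  fixes X :: "'a topology"
  assumes "polish_topology X"
  obtains g :: "'a \<Rightarrow> nat \<Rightarrow> real" where "inj_on g (topspace X)"
proof -
  obtain M d where Md: "Metric_space M d" and X: "X = Metric_space.mtopology M d"
    using assms unfolding polish_topology_def completely_metrizable_space_def by blast
  interpret Metric_space M d by (rule Md)
  obtain D where D: "countable D" "D \<subseteq> M" "mtopology closure_of D = M"
    using assms unfolding polish_topology_def separable_space_def X by auto
  define g where "g x = (\<lambda>n. d x (from_nat_into D n))" for x
  have "inj_on g M"
  proof (rule inj_onI)
    fix x y assume xy: "x \<in> M" "y \<in> M" "g x = g y"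
    then have "D \<noteq> {}" using D by auto
    have eq: "d x z = d y z" if "z \<in> D" for z
    proof -
      obtain n where "from_nat_into D n = z"
        using from_nat_into_surj[OF D(1) \<open>z \<in> D\<close>] by blast
      with fun_cong[OF xy(3), of n] show ?thesis by (simp add: g_def)
    qed
    show "x = y"
    proof (rule ccontr)
      assume "x \<noteq> y"
      with xy have pos: "d x y / 2 > 0" by simp
      from xy D(3) have "x \<in> mtopology closure_of D" by simp
      then obtain z where z: "z \<in> D" "z \<in> mball x (d x y / 2)"
        using pos unfolding metric_closure_of by blast
      then have "d x z < d x y / 2" "z \<in> M" by auto
      moreover have "d x y \<le> d x z + d z y"
        using xy \<open>z \<in> M\<close> triangle by blast
      ultimately show False using eq[OF z(1)] commute[of z y] by linarith
    qed
  qed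
  then show thesis using that X by simp
qed

lemma analytic_inI:
  fixes X :: "'b topology"
  assumes "polish_topology X" "continuous_map X T f" "f ` topspace X = S"
  shows "analytic_in T S"
proof -
  obtain g :: "'b \<Rightarrow> nat \<Rightarrow> real" where g: "inj_on g (topspace X)"
    using polish_topology_embedding[OF assms(1)] .
  define h where "h = inv_into (topspace X) g"
  define Y where "Y = pullback_topology (g ` topspace X) h X"
  have hg: "h (g x) = x" if "x \<in> topspace X" for x
    using g that by (simp add: h_def)
  have topY: "topspace Y = g ` topspace X"
    by (auto simp: Y_def topspace_pullback_topology hg)
  have ch: "continuous_map Y X h"
    using continuous_map_pullback[of X X id "g ` topspace X" h]
    by (simp add: Y_def)
  have cg: "continuous_map X Y g"
    unfolding Y_def
  proof (rule continuous_map_pullback')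
    show "continuous_map X X (h \<circ> g)"
      by (rule continuous_map_eq[OF continuous_map_id]) (simp add: hg)
    show "topspace X \<subseteq> g -` (g ` topspace X)" by blast
  qed
  have "homeomorphic_maps X Y g h"
    using ch cg hg by (auto simp: homeomorphic_maps_def topY)
  then have "polish_topology Y"
    using assms(1) polish_topology_homeomorphic homeomorphic_space_def by blast
  moreover have "continuous_map Y T (f \<circ> h)"
    using ch assms(2) by (rule continuous_map_compose)
  moreover have "(f \<circ> h) ` topspace Y = S"
    using assms(3) by (force simp: topY hg image_iff)
  ultimately show ?thesis unfolding analytic_in_def by blast
qed

definition topological_group :: "('a, 'm) monoid_scheme \<Rightarrow> 'a topology \<Rightarrow> bool" where
  "topological_group L T \<longleftrightarrow> group L \<and> topspace T = carrier L \<and>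
     continuous_map (prod_topology T T) T (\<lambda>(x, y). x \<otimes>\<^bsub>L\<^esub> y) \<and>
     continuous_map T T (\<lambda>x. inv\<^bsub>L\<^esub> x)"

definition polish_group :: "('a, 'm) monoid_scheme \<Rightarrow> 'a topology \<Rightarrow> bool" where
  "polish_group L T \<longleftrightarrow> topological_group L T \<and> polish_topology T"

definition analytic_subgroup :: "'a set \<Rightarrow> ('a, 'm) monoid_scheme \<Rightarrow> 'a topology \<Rightarrow> bool" where
  "analytic_subgroup H L T \<longleftrightarrow> subgroup H L \<and> analytic_in T H"

definition GL :: "(real^'n^'n) set" where
  "GL = {A. invertible A}"

definition SL :: "(real^'n^'n) set" where
  "SL = {A. det A = 1}"

definition abs_SL :: "(real^'n^'n) set" where
  "abs_SL = {A \<in> GL. \<bar>det A\<bar> = 1}"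

definition GL_plus :: "(real^'n^'n) set" where
  "GL_plus = {A \<in> GL. det A > 0}"

definition SO :: "(real^'n^'n) set" where
  "SO = {A. rotation_matrix A}"

definition semidirect :: "(real^'n^'n) set \<Rightarrow> ((real^'n) \<times> (real^'n^'n)) monoid" where
  "semidirect G = \<lparr>carrier = UNIV \<times> G,
     mult = (\<lambda>(x, A) (y, B). (x + A *v y, A ** B)),
     one = (0, mat 1)\<rparr>"

definition embed_matrices :: "(real^'n^'n) set \<Rightarrow> ((real^'n) \<times> (real^'n^'n)) set" where
  "embed_matrices S = {(0, A) | A. A \<in> S}"

lemma group_semidirect:
  assumes "G \<in> {GL, SL, abs_SL, GL_plus :: (real^'n^'n) set}"
  shows "group (semidirect G)"
proof (rule groupI)
  have mult: "A ** B \<in> G" if "A \<in> G" "B \<in> G" for A B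
    using assms that
    by (auto simp: GL_def SL_def abs_SL_def GL_plus_def det_mul abs_mult
        invertible_mult zero_less_mult_iff)
  have one: "mat 1 \<in> G"
    using assms by (auto simp: GL_def SL_def abs_SL_def GL_plus_def invertible_det_nz)
  have inverse: "\<exists>B \<in> G. B ** A = mat 1" if "A \<in> G" for A
  proof -
    have "invertible A"
      using assms that by (auto simp: GL_def SL_def abs_SL_def GL_plus_def invertible_det_nz)
    then obtain B where B: "A ** B = mat 1" "B ** A = mat 1"
      unfolding invertible_def by blast
    then have "invertible B" unfolding invertible_def by blast
    have d: "det B * det A = 1" by (metis B(2) det_I det_mul)
    then have e: "\<bar>det B\<bar> * \<bar>det A\<bar> = 1" by (metis abs_mult abs_one)
    have "det B > 0" if "det A > 0"
      using d that by (metis zero_less_mult_pos2 zero_less_one)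
    then have "B \<in> G"
      using assms \<open>invertible B\<close> \<open>A \<in> G\<close> d e
      by (auto simp: GL_def SL_def abs_SL_def GL_plus_def)
    with B show ?thesis by blast
  qed
  show "x \<otimes>\<^bsub>semidirect G\<^esub> y \<in> carrier (semidirect G)"
    if "x \<in> carrier (semidirect G)" "y \<in> carrier (semidirect G)" for x y
    using that mult by (auto simp: semidirect_def)
  show "\<one>\<^bsub>semidirect G\<^esub> \<in> carrier (semidirect G)"
    using one by (simp add: semidirect_def)
  show "x \<otimes>\<^bsub>semidirect G\<^esub> y \<otimes>\<^bsub>semidirect G\<^esub> z =
        x \<otimes>\<^bsub>semidirect G\<^esub> (y \<otimes>\<^bsub>semidirect G\<^esub> z)" for x y z
    by (simp add: semidirect_def split_beta matrix_vector_right_distrib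
        matrix_vector_mul_assoc matrix_mul_assoc)
  show "\<one>\<^bsub>semidirect G\<^esub> \<otimes>\<^bsub>semidirect G\<^esub> x = x" for x
    by (simp add: semidirect_def split_beta)
  show "\<exists>y \<in> carrier (semidirect G). y \<otimes>\<^bsub>semidirect G\<^esub> x = \<one>\<^bsub>semidirect G\<^esub>"
    if x: "x \<in> carrier (semidirect G)" for x
  proof -
    obtain v A where xA: "x = (v, A)" "A \<in> G" using x by (auto simp: semidirect_def)
    with inverse obtain B where "B \<in> G" "B ** A = mat 1" by blast
    then show ?thesis
      by (intro bexI[of _ "(- (B *v v), B)"]) (auto simp: semidirect_def xA)
  qed
qed

end

theory Submission
  imports Defs
begin

text \<open>
  The idea is to see enough of the matrix part of \<open>\<phi>\<close> from the algebra of \<open>L\<close>. The lines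
  \<open>{(t e\<^sub>k, I)}\<close> are double centralizers, hence closed in \<open>L\<close>. An element whose matrix maps \<open>e\<^sub>k\<close> to \<open>s e\<^sub>k\<close>
  multiplies such a line by \<open>s\<close>, so the segment \<open>0 < t < 1\<close> is the continuous image of the closed set of
  pairs of scalings \<open>s, s'\<close> of the line with \<open>s\<^sup>2 + s'\<^sup>2 = 1\<close>. A homomorphism from a Polish group to the reals
  that is bounded on an analytic set with countably many translates covering the group is
  continuous, by Pettis' argument. So \<open>t\<close> is continuous on each line. The matrix entries
  can be read off by commutators with transvections, so \<open>(x, A) \<mapsto> A\<close> is continuous on \<open>L\<close>.

  It remains to express \<open>x = 0\<close> for \<open>h = (x, A)\<close> with \<open>A\<close> a rotation. Let \<open>D\<close> be a matrix of determinant 1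
  without eigenvalue 1, with \<open>e\<close> spanning one eigenspace and its orthogonal complement the other.
  Elements commuting with \<open>(0, D)\<close> fix the origin. If \<open>k\<close> and \<open>h\<^sup>-\<^sup>1 k h\<close> both do, then \<open>k = (0, E)\<close> fixes
  \<open>x\<close>, so \<open>x = 0\<close> as soon as \<open>(E - d)(E - 1/4) = 0\<close> with \<open>d \<noteq> 1\<close>. Conversely, for \<open>x = 0\<close> such an
  \<open>E\<close> exists: let it act as \<open>d\<close> on a plane containing \<open>e\<close> and \<open>A e\<close> and as \<open>1/4\<close> on the orthogonal complement.
  These are closed conditions on \<open>(h, k, h\<^sup>-\<^sup>1 k h)\<close>.
\<close>

section \<open>Meager sets and Baire category\<close>

text \<open>Covering by closed sets with empty interior, rather than by arbitrary nowhere dense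
  sets, lets the Baire category theorem act on the cover itself.\<close>

definition meager_in :: "'a topology \<Rightarrow> 'a set \<Rightarrow> bool" where
  "meager_in X S \<longleftrightarrow> (\<exists>\<C>. countable \<C> \<and> (\<forall>C\<in>\<C>. closedin X C \<and> X interior_of C = {}) \<and> S \<subseteq> \<Union>\<C>)"

lemma meager_in_subset: "meager_in X S \<Longrightarrow> S' \<subseteq> S \<Longrightarrow> meager_in X S'"
  unfolding meager_in_def by (elim exE, rule exI) auto

lemma meager_in_closed: "closedin X C \<Longrightarrow> X interior_of C = {} \<Longrightarrow> meager_in X C"
  unfolding meager_in_def by (intro exI[of _ "{C}"]) auto

text \<open>An open set inside the boundary of \<open>C\<close> would already lie in the interior
  that was removed.\<close>

lemma meager_in_Diff_interior_of:
  assumes "closedin X C"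
  shows "meager_in X (C - X interior_of C)"
proof (rule meager_in_closed)
  show "closedin X (C - X interior_of C)"
    using assms by (simp add: closedin_diff)
  let ?I = "X interior_of (C - X interior_of C)"
  have "?I \<subseteq> C - X interior_of C" by (rule interior_of_subset)
  moreover from this have "?I \<subseteq> X interior_of C" by (intro interior_of_maximal) auto
  ultimately show "?I = {}" by blast
qed

lemma meager_in_Union:
  assumes "countable \<S>" "\<And>S. S \<in> \<S> \<Longrightarrow> meager_in X S"
  shows "meager_in X (\<Union>\<S>)"
proof -
  let ?P = "\<lambda>S \<C>. countable \<C> \<and> (\<forall>C\<in>\<C>. closedin X C \<and> X interior_of C = {}) \<and> S \<subseteq> \<Union>\<C>"
  have "\<forall>S\<in>\<S>. \<exists>\<C>. ?P S \<C>"
    using assms(2) unfolding meager_in_def by (rule ballI)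
  then obtain \<C> where "\<forall>S\<in>\<S>. ?P S (\<C> S)" by (rule exE[OF bchoice])
  then have \<C>: "?P S (\<C> S)" if "S \<in> \<S>" for S using that by (rule bspec)
  show ?thesis
    unfolding meager_in_def
  proof (intro exI[of _ "\<Union>(\<C> ` \<S>)"] conjI)
    show "countable (\<Union>(\<C> ` \<S>))" using assms(1) \<C> by (auto intro: countable_UN)
  next
    show "\<forall>C\<in>\<Union> (\<C> ` \<S>). closedin X C \<and> X interior_of C = {}" using \<C> by blast
    show "\<Union> \<S> \<subseteq> \<Union> (\<Union> (\<C> ` \<S>))" 
    proof
      fix x assume "x \<in> \<Union> \<S>"
      then obtain S where S: "S \<in> \<S>" "x \<in> S" by blast
      with \<C>[OF S(1)] obtain C where "C \<in> \<C> S" "x \<in> C" by blast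
      with S(1) show "x \<in> \<Union> (\<Union> (\<C> ` \<S>))" by blast
    qed
  qed
qed

lemma meager_in_UN:
  assumes "countable I" "\<And>i. i \<in> I \<Longrightarrow> meager_in X (S i)"
  shows "meager_in X (\<Union>i\<in>I. S i)"
proof (rule meager_in_Union)
  show "countable (S ` I)" using assms(1) by simp
qed (use assms(2) in auto)

lemma meager_in_Un: "meager_in X A \<Longrightarrow> meager_in X B \<Longrightarrow> meager_in X (A \<union> B)"
  by (rule meager_in_Union[of "{A, B}" X, simplified]) auto

lemma meager_in_empty: "meager_in X {}"
  using meager_in_Union[of "{}" X] by simp

lemma not_meager_in_open:
  assumes "completely_metrizable_space X" "openin X W" "W \<noteq> {}"
  shows "\<not> meager_in X W"
proof
  assume "meager_in X W"
  then obtain \<C> where \<C>: "countable \<C>" "\<And>C. C \<in> \<C> \<Longrightarrow> closedin X C \<and> X interior_of C = {}" "W \<subseteq> \<Union>\<C>"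
    unfolding meager_in_def by blast
  then have "X interior_of \<Union>\<C> = {}"
    using assms(1) by (intro Baire_category_alt) auto
  moreover have "W \<subseteq> X interior_of \<Union>\<C>"
    using assms(2) \<C>(3) by (rule interior_of_maximal[rotated])
  ultimately show False using assms(3) by blast
qed

lemma meager_in_homeomorphic_image:
  assumes h: "homeomorphic_map X Y h" and S: "meager_in X S" "S \<subseteq> topspace X"
  shows "meager_in Y (h ` S)"
proof -
  obtain \<C> where \<C>: "countable \<C>" "\<And>C. C \<in> \<C> \<Longrightarrow> closedin X C \<and> X interior_of C = {}" "S \<subseteq> \<Union>\<C>"
    using S unfolding meager_in_def by blast
  show ?thesis
    unfolding meager_in_def
  proof (intro exI[of _ "image h ` \<C>"] conjI ballI)
    fix D assume "D \<in> image h ` \<C>"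
    then obtain C where C: "C \<in> \<C>" "D = h ` C" by blast
    with \<C> have cl: "closedin X C" "X interior_of C = {}" by auto
    then have "C \<subseteq> topspace X" by (simp add: closedin_subset)
    then show "closedin Y D" "Y interior_of D = {}"
      using cl homeomorphic_map_closedness[OF h, of C] homeomorphic_map_interior_of[OF h, of C]
      by (simp_all add: C)
  next
    show "h ` S \<subseteq> \<Union> (image h ` \<C>)" using \<C>(3) by blast
  qed (use \<C> in auto)
qed

section \<open>Polish spaces: countable bases, closed subspaces, products\<close>

lemma polish_topology_second_countable:
  assumes "polish_topology X"
  shows "second_countable X"
proof -
  obtain M d where Md: "Metric_space M d" and X: "X = Metric_space.mtopology M d"
    using assms unfolding polish_topology_def completely_metrizable_space_def by blast
  interpret Metric_space M d by (rule Md)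
  obtain D where D: "countable D" "D \<subseteq> M" "mtopology closure_of D = M"
    using assms unfolding polish_topology_def separable_space_def X by auto
  define \<B> where "\<B> = (\<lambda>(x, n). mball x (1 / Suc n)) ` (D \<times> (UNIV :: nat set))"
  have "\<exists>V\<in>\<B>. x \<in> V \<and> V \<subseteq> U" if U: "openin X U" "x \<in> U" for U x
  proof -
    obtain r where r: "r > 0" "mball x r \<subseteq> U" "x \<in> M"
      using U unfolding X openin_mtopology by blast
    obtain n where n: "1 / Suc n < r / 2"
      using nat_approx_posE[of "r / 2"] r(1) by auto
    have "x \<in> mtopology closure_of D" using D r by simp
    then have "\<forall>r>0. \<exists>z\<in>D. z \<in> mball x r"
      unfolding metric_closure_of by blast
    then obtain z where z: "z \<in> D" "z \<in> mball x (1 / Suc n)"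
      using zero_less_divide_1_iff[of "real (Suc n)"] of_nat_0_less_iff[of "Suc n"] by blast
    have "mball z (1 / Suc n) \<subseteq> mball x r"
    proof
      fix y assume y: "y \<in> mball z (1 / Suc n)"
      with z have "d x y \<le> d x z + d z y" using triangle by auto
      with y z n show "y \<in> mball x r" by auto
    qed
    moreover have "x \<in> mball z (1 / Suc n)" using z by (auto simp: commute)
    ultimately show ?thesis using z(1) r(2) by (intro bexI[of _ "mball z (1 / Suc n)"]) (auto simp: \<B>_def)
  qed
  moreover have "countable \<B>" unfolding \<B>_def using D by blast
  moreover have "openin X V" if "V \<in> \<B>" for V using that by (auto simp: \<B>_def X)
  ultimately show ?thesis unfolding second_countable_def by blast
qed

lemma polish_topology_closedin:
  assumes "polish_topology X" "closedin X C"
  shows "polish_topology (subtopology X C)"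
  using assms polish_topology_second_countable[OF assms(1)]
  by (simp add: polish_topology_def completely_metrizable_space_closedin
      second_countable_imp_separable_space second_countable_subtopology)

lemma polish_topology_prod:
  assumes "polish_topology X" "polish_topology Y"
  shows "polish_topology (prod_topology X Y)"
proof -
  obtain C D where C: "countable C" "C \<subseteq> topspace X" "X closure_of C = topspace X"
    and D: "countable D" "D \<subseteq> topspace Y" "Y closure_of D = topspace Y"
    using assms unfolding polish_topology_def separable_space_def by auto
  have "separable_space (prod_topology X Y)"
    unfolding separable_space_def
  proof (intro exI[of _ "C \<times> D"] conjI)
    show "countable (C \<times> D)" using C D by simp
    show "C \<times> D \<subseteq> topspace (prod_topology X Y)" using C D by auto
    show "prod_topology X Y closure_of (C \<times> D) = topspace (prod_topology X Y)"
      using C D by (simp add: closure_of_Times)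
  qed
  with assms show ?thesis
    by (simp add: polish_topology_def completely_metrizable_space_prod_topology)
qed

lemma polish_topology_Hausdorff: "polish_topology X \<Longrightarrow> Hausdorff_space X"
  by (simp add: polish_topology_def completely_metrizable_imp_metrizable_space
      metrizable_imp_Hausdorff_space)

text \<open>Kuratowski's localization: the points at which \<open>S\<close> is not locally meager.
  In a Polish space, for an analytic \<open>S\<close>, this closed set differs from \<open>S\<close>
  only by a meager set.\<close>

definition nonmeager_points :: "'a topology \<Rightarrow> 'a set \<Rightarrow> 'a set" where
  "nonmeager_points X S = {y \<in> topspace X. \<forall>N. openin X N \<longrightarrow> y \<in> N \<longrightarrow> \<not> meager_in X (S \<inter> N)}"

lemma closedin_nonmeager_points: "closedin X (nonmeager_points X S)"
proof -
  have "topspace X - nonmeager_points X S = \<Union>{N. openin X N \<and> meager_in X (S \<inter> N)}"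
    by (auto simp: nonmeager_points_def dest: openin_subset)
  moreover have "openin X (\<Union>{N. openin X N \<and> meager_in X (S \<inter> N)})"
    by blast
  ultimately show ?thesis
    by (simp add: closedin_def nonmeager_points_def)
qed

text \<open>Each removed point has a basic neighbourhood in which \<open>S\<close> is meager, and
  there are only countably many basic sets.\<close>

lemma meager_in_Diff_nonmeager_points:
  assumes "second_countable X" "S \<subseteq> topspace X"
  shows "meager_in X (S - nonmeager_points X S)"
proof -
  obtain \<B> where \<B>: "countable \<B>" "\<And>V. V \<in> \<B> \<Longrightarrow> openin X V"
    "\<And>U x. openin X U \<and> x \<in> U \<longrightarrow> (\<exists>V \<in> \<B>. x \<in> V \<and> V \<subseteq> U)"
    using assms(1) by (auto simp: second_countable_def)
  have "S - nonmeager_points X S \<subseteq> (\<Union>V\<in>{V\<in>\<B>. meager_in X (S \<inter> V)}. S \<inter> V)"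
  proof
    fix y assume y: "y \<in> S - nonmeager_points X S"
    then obtain N where N: "openin X N" "y \<in> N" "meager_in X (S \<inter> N)"
      using assms(2) by (auto simp: nonmeager_points_def)
    then obtain V where "V \<in> \<B>" "y \<in> V" "V \<subseteq> N" using \<B>(3) by blast
    moreover have "meager_in X (S \<inter> V)"
      using N(3) by (rule meager_in_subset) (use \<open>V \<subseteq> N\<close> in blast)
    ultimately show "y \<in> (\<Union>V\<in>{V\<in>\<B>. meager_in X (S \<inter> V)}. S \<inter> V)" using y by blast
  qed
  moreover have "meager_in X (\<Union>V\<in>{V\<in>\<B>. meager_in X (S \<inter> V)}. S \<inter> V)"
  proof (rule meager_in_UN)
    show "countable {V \<in> \<B>. meager_in X (S \<inter> V)}" by (rule countable_subset[OF _ \<B>(1)]) blast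
  qed simp
  ultimately show ?thesis by (rule meager_in_subset[rotated])
qed

lemma nonmeager_points_empty: "nonmeager_points X {} = {}"
  by (auto simp: nonmeager_points_def meager_in_empty intro!: exI[of _ "topspace X"])

text \<open>With interiors in place of the sets \<open>nonmeager_points X (A i)\<close> the
  difference becomes closed, so it suffices that its interior is empty. In an open \<open>W\<close>
  missed by these interiors every \<open>A i\<close> is meager, hence so is
  \<open>S\<close>.\<close>

lemma meager_in_nonmeager_points_Diff_UN:
  assumes X: "second_countable X" and I: "countable I"
    and S: "S \<subseteq> (\<Union>i\<in>I. A i)" and A: "\<And>i. i \<in> I \<Longrightarrow> A i \<subseteq> topspace X"
  shows "meager_in X (nonmeager_points X S - (\<Union>i\<in>I. nonmeager_points X (A i)))"
proof -
  let ?U = "\<Union>i\<in>I. X interior_of nonmeager_points X (A i)"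
  have cl: "closedin X (nonmeager_points X S - ?U)"
  proof (rule closedin_diff[OF closedin_nonmeager_points])
    show "openin X ?U" by (rule openin_Union) (auto simp: openin_interior_of)
  qed
  have "X interior_of (nonmeager_points X S - ?U) = {}"
  proof (rule ccontr)
    assume ne: "X interior_of (nonmeager_points X S - ?U) \<noteq> {}"
    define W where "W = X interior_of (nonmeager_points X S - ?U)"
    have W: "openin X W" "W \<subseteq> nonmeager_points X S" "W \<inter> ?U = {}"
      using interior_of_subset[of X "nonmeager_points X S - ?U"] unfolding W_def by auto
    have "\<not> meager_in X (S \<inter> W)"
      using ne W unfolding W_def nonmeager_points_def by blast
    moreover have "meager_in X (S \<inter> W)" if "meager_in X (\<Union>i\<in>I. A i \<inter> W)"
      using that by (rule meager_in_subset) (use S in blast)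
    ultimately obtain i where i: "i \<in> I" "\<not> meager_in X (A i \<inter> W)"
      using meager_in_UN[OF I, of X "\<lambda>i. A i \<inter> W"] by blast
    let ?D = "nonmeager_points X (A i)"
    \<comment> \<open>\<open>W\<close> avoids the interior of \<open>?D\<close>, so the part of
      \<open>A i\<close> in \<open>W\<close> and in \<open>?D\<close> lies in the boundary of
      \<open>?D\<close>.\<close>
    have "A i \<inter> W \<subseteq> (A i - ?D) \<union> (?D - X interior_of ?D)" using W(3) i(1) by blast
    moreover have "meager_in X (?D - X interior_of ?D)"
      by (rule meager_in_Diff_interior_of[OF closedin_nonmeager_points])
    moreover have "meager_in X (A i - ?D)"
      using i by (intro meager_in_Diff_nonmeager_points[OF X A])
    ultimately have "meager_in X (A i \<inter> W)"
      by (meson meager_in_Un meager_in_subset)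
    with i(2) show False ..
  qed
  with cl have "meager_in X (nonmeager_points X S - ?U)" by (rule meager_in_closed)
  then show ?thesis
  proof (rule meager_in_subset)
    show "nonmeager_points X S - (\<Union>i\<in>I. nonmeager_points X (A i)) \<subseteq> nonmeager_points X S - ?U"
      using interior_of_subset[of X "nonmeager_points X (A i)" for i] by blast
  qed
qed

text \<open>The substantial half of the Baire property of analytic sets. Off a meager set, local
  nonmeagerness of the image passes from each piece of a Souslin scheme to some subpiece, and
  following these pieces leads to a preimage.\<close>

lemma meager_in_nonmeager_points_Diff_continuous_image:
  assumes X: "polish_topology X" and Y: "polish_topology Y" and p: "continuous_map X Y p"
  shows "meager_in Y (nonmeager_points Y (p ` topspace X) - p ` topspace X)"
proof (cases "topspace X = {}")
  case True
  then show ?thesis by (simp add: nonmeager_points_empty meager_in_empty)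
next
  case False
  obtain M d where Md: "Metric_space M d" "Metric_space.mcomplete M d" and XM: "X = Metric_space.mtopology M d"
    using X unfolding polish_topology_def completely_metrizable_space_def by blast
  interpret M: Metric_space M d by (rule Md)
  obtain N e where Ne: "Metric_space N e" and YN: "Y = Metric_space.mtopology N e"
    using Y unfolding polish_topology_def completely_metrizable_space_def by blast
  interpret N: Metric_space N e by (rule Ne)
  obtain D where D: "countable D" "D \<subseteq> M" "M.mtopology closure_of D = M"
    using X unfolding polish_topology_def separable_space_def XM by auto
  have "D \<noteq> {}" using D(3) False by (auto simp: XM)
  define q where "q = from_nat_into D"
  have q: "range q = D" unfolding q_def using D(1) \<open>D \<noteq> {}\<close> by (rule range_from_nat_into[rotated])
  \<comment> \<open>A finite list selects nested pieces of shrinking diameter. A point that is never lost when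
    a piece is split gives a Cauchy sequence upstairs, whose limit is mapped to it.\<close>
  define V where "V l = M \<inter> (\<Inter>j\<in>{..<length l}. M.mball (q (l ! j)) (1 / Suc j))" for l
  have V_snoc: "V (l @ [a]) = V l \<inter> M.mball (q a) (1 / Suc (length l))" for l a
    by (auto simp: V_def nth_append lessThan_Suc simp del: of_nat_Suc)
  have V_M: "V l \<subseteq> M" for l by (auto simp: V_def)
  have V_cover: "V l \<subseteq> (\<Union>a. V (l @ [a]))" for l
  proof
    fix x assume x: "x \<in> V l"
    then have "x \<in> M.mtopology closure_of D" using D V_M by auto
    then have "\<forall>r>0. \<exists>z\<in>D. z \<in> M.mball x r"
      unfolding M.metric_closure_of by blast
    then obtain z where z: "z \<in> D" "z \<in> M.mball x (1 / Suc (length l))"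
      using zero_less_divide_1_iff[of "real (Suc (length l))"] of_nat_0_less_iff[of "Suc (length l)"] by blast
    then obtain a where "q a = z" using q by blast
    with z x have "x \<in> V (l @ [a])" by (auto simp: V_snoc M.commute)
    then show "x \<in> (\<Union>a. V (l @ [a]))" by blast
  qed
  have pV: "p ` V l \<subseteq> topspace Y" for l
    using V_M[of l] continuous_map_image_subset_topspace[OF p] by (auto simp: XM)
  let ?D = "\<lambda>l. nonmeager_points Y (p ` V l)"
  \<comment> \<open>The points lost at some splitting. Lists of naturals are countable, so
    \<open>meager_in_nonmeager_points_Diff_UN\<close> makes this set meager.\<close>
  define E where "E = (\<Union>l. ?D l - (\<Union>a. ?D (l @ [a])))"
  have "meager_in Y E"
    unfolding E_def
  proof (rule meager_in_UN)
    show "meager_in Y (?D l - (\<Union>a. ?D (l @ [a])))" for l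
    proof (rule meager_in_nonmeager_points_Diff_UN)
      show "second_countable Y" using Y by (rule polish_topology_second_countable)
      show "p ` V l \<subseteq> (\<Union>a. p ` V (l @ [a]))" using V_cover[of l] by blast
    qed (use pV in auto)
  qed simp
  moreover have "nonmeager_points Y (p ` topspace X) - p ` topspace X \<subseteq> E"
  proof
    fix y assume y: "y \<in> nonmeager_points Y (p ` topspace X) - p ` topspace X"
    show "y \<in> E"
    proof (rule ccontr)
      assume "y \<notin> E"
      then have step: "\<exists>a. y \<in> ?D (l @ [a])" if "y \<in> ?D l" for l
        using that by (auto simp: E_def)
      have y0: "y \<in> ?D []" using y by (simp add: V_def XM)
      have "\<exists>L. \<forall>n. (length (L n) = n \<and> y \<in> ?D (L n)) \<and> (\<exists>a. L (Suc n) = L n @ [a])"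
      proof (rule dependent_nat_choice)
        show "\<exists>l. length l = 0 \<and> y \<in> ?D l" using y0 by simp
        show "\<exists>l'. (length l' = Suc n \<and> y \<in> ?D l') \<and> (\<exists>a. l' = l @ [a])"
          if l: "length l = n \<and> y \<in> ?D l" for l n
        proof -
          obtain a where "y \<in> ?D (l @ [a])" using step l by blast
          then show ?thesis using l by (intro exI[of _ "l @ [a]"]) auto
        qed
      qed
      then obtain L where "\<forall>n. (length (L n) = n \<and> y \<in> ?D (L n)) \<and> (\<exists>a. L (Suc n) = L n @ [a])" ..
      then have L: "length (L n) = n" "y \<in> ?D (L n)" "\<exists>a. L (Suc n) = L n @ [a]" for n
        by auto
      have yN: "y \<in> N" using y by (auto simp: nonmeager_points_def YN)
      \<comment> \<open>The empty set is meager, so every neighbourhood of \<open>y\<close> meets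
        the image of \<open>V (L n)\<close>.\<close>
      have "\<exists>x. x \<in> V (L n) \<and> p x \<in> N.mball y (1 / Suc n)" for n
      proof -
        have "\<not> meager_in Y (p ` V (L n) \<inter> N.mball y (1 / Suc n))"
          using L(2)[of n] yN unfolding nonmeager_points_def
          by (auto simp: YN simp del: of_nat_Suc)
        then have "p ` V (L n) \<inter> N.mball y (1 / Suc n) \<noteq> {}"
          by (metis meager_in_empty)
        then show ?thesis by blast
      qed
      then obtain x where x: "x n \<in> V (L n)" "p (x n) \<in> N.mball y (1 / Suc n)" for n by metis
      have mono: "V (L (n + k)) \<subseteq> V (L n)" for n k
      proof (induction k)
        case (Suc k)
        obtain a where "L (Suc (n + k)) = L (n + k) @ [a]" using L(3) by blast
        then have "V (L (n + Suc k)) \<subseteq> V (L (n + k))" by (simp add: V_snoc)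
        with Suc show ?case by blast
      qed simp
      have "M.MCauchy x"
        unfolding M.MCauchy_def
      proof (intro conjI allI impI)
        show "range x \<subseteq> M" using x(1) V_M by blast
        fix \<epsilon> :: real assume "\<epsilon> > 0"
        then obtain n where n: "1 / Suc n < \<epsilon> / 2" using nat_approx_posE[of "\<epsilon> / 2"] by auto
        obtain a where a: "L (Suc n) = L n @ [a]" using L(3) by blast
        \<comment> \<open>From index \<open>Suc n\<close> on, all points share the ball added when
          \<open>L n\<close> was extended, so their distances are below
          \<open>2 / Suc n\<close>.\<close>
        have b: "x k \<in> M.mball (q a) (1 / Suc n)" if "k \<ge> Suc n" for k
        proof -
          have "x k \<in> V (L (Suc n))"
            using x(1)[of k] mono[of "Suc n" "k - Suc n"] that by auto
          then show ?thesis by (simp add: a V_snoc L(1))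
        qed
        show "\<exists>K. \<forall>k k'. K \<le> k \<longrightarrow> K \<le> k' \<longrightarrow> d (x k) (x k') < \<epsilon>"
        proof (intro exI[of _ "Suc n"] allI impI)
          fix k k' assume "Suc n \<le> k" "Suc n \<le> k'"
          from b[OF this(1)] b[OF this(2)] n M.triangle[of "x k" "q a" "x k'"] M.commute[of "q a" "x k"]
          show "d (x k) (x k') < \<epsilon>" by (auto simp del: of_nat_Suc)
        qed
      qed
      then obtain z where z: "limitin M.mtopology x z sequentially"
        using Md(2) M.mcomplete_def by blast
      \<comment> \<open>The balls are open, so the limit may leave the pieces; membership in
        \<open>M\<close> already puts \<open>p z\<close> in the image.\<close>
      then have "z \<in> M" by (simp add: M.limitin_metric)
      have "limitin Y (p \<circ> x) (p z) sequentially"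
        using p z unfolding XM by (rule continuous_map_limit)
      moreover have "limitin Y (p \<circ> x) y sequentially"
        unfolding YN N.limitin_metric
      proof (intro conjI yN allI impI)
        fix \<epsilon> :: real assume "\<epsilon> > 0"
        then obtain n where n: "1 / Suc n < \<epsilon>" using nat_approx_posE by auto
        show "\<forall>\<^sub>F k in sequentially. (p \<circ> x) k \<in> N \<and> e ((p \<circ> x) k) y < \<epsilon>"
          unfolding eventually_sequentially
        proof (intro exI[of _ n] allI impI)
          fix k assume "n \<le> k"
          then have "1 / Suc k \<le> 1 / real (Suc n)" by (simp add: frac_le)
          with n x(2)[of k] show "(p \<circ> x) k \<in> N \<and> e ((p \<circ> x) k) y < \<epsilon>"
            by (auto simp: N.commute simp del: of_nat_Suc)
        qed
      qed
      ultimately have "p z = y"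
        using limitin_Hausdorff_unique[OF _ _ trivial_limit_sequentially polish_topology_Hausdorff[OF Y]] by blast
      with y \<open>z \<in> M\<close> show False by (auto simp: XM)
    qed
  qed
  ultimately show ?thesis by (rule meager_in_subset)
qed

text \<open>\<open>W\<close> is the interior of \<open>nonmeager_points\<close>. Were it empty, that
  closed set would be meager, and so would be the image, which exceeds it only by a meager
  set.\<close>

lemma nonmeager_continuous_image_comeager:
  assumes X: "polish_topology X" and Y: "polish_topology Y" and p: "continuous_map X Y p"
    and nm: "\<not> meager_in Y (p ` topspace X)"
  obtains W where "openin Y W" "W \<noteq> {}" "meager_in Y (W - p ` topspace X)"
proof
  let ?S = "p ` topspace X" and ?W = "Y interior_of nonmeager_points Y (p ` topspace X)"
  have S: "?S \<subseteq> topspace Y" using continuous_map_image_subset_topspace[OF p] .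
  show "openin Y ?W" by simp
  have "?W \<subseteq> nonmeager_points Y ?S" by (rule interior_of_subset)
  then show "meager_in Y (?W - ?S)"
    by (intro meager_in_subset[OF meager_in_nonmeager_points_Diff_continuous_image[OF X Y p]]) blast
  show "?W \<noteq> {}"
  proof
    assume "?W = {}"
    then have "meager_in Y (nonmeager_points Y ?S)"
      by (intro meager_in_closed closedin_nonmeager_points)
    moreover have "meager_in Y (?S - nonmeager_points Y ?S)"
      by (rule meager_in_Diff_nonmeager_points[OF polish_topology_second_countable[OF Y] S])
    ultimately have "meager_in Y (nonmeager_points Y ?S \<union> (?S - nonmeager_points Y ?S))"
      by (rule meager_in_Un)
    then have "meager_in Y ?S" by (rule meager_in_subset) blast
    with nm show False ..
  qed
qed

section \<open>Automatic continuity of homomorphisms into the reals\<close>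

lemma continuous_map_group_mult:
  assumes "topological_group L T" "continuous_map X T f" "continuous_map X T g"
  shows "continuous_map X T (\<lambda>x. f x \<otimes>\<^bsub>L\<^esub> g x)"
proof -
  have "continuous_map X (prod_topology T T) (\<lambda>x. (f x, g x))"
    using assms(2,3) by (simp add: continuous_map_pairedI)
  then have "continuous_map X T ((\<lambda>(x, y). x \<otimes>\<^bsub>L\<^esub> y) \<circ> (\<lambda>x. (f x, g x)))"
    using assms(1) unfolding topological_group_def by (intro continuous_map_compose) auto
  then show ?thesis by (simp add: o_def)
qed

lemma continuous_map_group_inv:
  assumes "topological_group L T" "continuous_map X T f"
  shows "continuous_map X T (\<lambda>x. inv\<^bsub>L\<^esub> (f x))"
proof -
  have "continuous_map X T ((\<lambda>x. inv\<^bsub>L\<^esub> x) \<circ> f)"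
    using assms unfolding topological_group_def by (intro continuous_map_compose) auto
  then show ?thesis by (simp add: o_def)
qed

lemma homeomorphic_map_left_translation:
  assumes L: "topological_group L T" and g: "g \<in> carrier L"
  shows "homeomorphic_map T T (\<lambda>x. g \<otimes>\<^bsub>L\<^esub> x)"
proof -
  interpret group L using L by (simp add: topological_group_def)
  have T: "topspace T = carrier L" using L by (simp add: topological_group_def)
  have "continuous_map T T (\<lambda>x. h \<otimes>\<^bsub>L\<^esub> x)" if "h \<in> carrier L" for h
    using that by (intro continuous_map_group_mult[OF L]) (simp_all add: T)
  then have "homeomorphic_maps T T (\<lambda>x. g \<otimes>\<^bsub>L\<^esub> x) (\<lambda>x. inv\<^bsub>L\<^esub> g \<otimes>\<^bsub>L\<^esub> x)"
    using g by (simp add: homeomorphic_maps_def T flip: m_assoc)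
  then show ?thesis by (rule homeomorphic_maps_imp_map)
qed

text \<open>Makes each closed subgroup \<open>line k\<close> a Polish group of its own, to which the
  continuity criterion applies.\<close>

lemma topological_group_subgroup:
  assumes L: "topological_group L T" and H: "subgroup H L"
  shows "topological_group (L\<lparr>carrier := H\<rparr>) (subtopology T H)"
proof -
  interpret group L using L by (simp add: topological_group_def)
  interpret H: subgroup H L by (rule H)
  have T: "topspace T = carrier L" using L by (simp add: topological_group_def)
  have top: "topspace (subtopology T H) = H" using H.subset by (auto simp: T)
  have id: "continuous_map (subtopology T H) T (\<lambda>x. x)"
    using continuous_map_from_subtopology[OF continuous_map_id[of T]] by (simp add: id_def)
  show ?thesis
    unfolding topological_group_def
  proof (intro conjI)
    show "group (L\<lparr>carrier := H\<rparr>)" using H by (rule subgroup_imp_group)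
    show "topspace (subtopology T H) = carrier (L\<lparr>carrier := H\<rparr>)"
      using top by simp
    let ?P = "prod_topology (subtopology T H) (subtopology T H)"
    have "continuous_map ?P T (\<lambda>z. fst z \<otimes>\<^bsub>L\<^esub> snd z)"
    proof (rule continuous_map_group_mult[OF L])
      show "continuous_map ?P T fst" "continuous_map ?P T snd"
        using continuous_map_compose[OF continuous_map_fst id]
          continuous_map_compose[OF continuous_map_snd id] by (simp_all add: o_def)
    qed
    then show "continuous_map ?P (subtopology T H) (\<lambda>(x, y). x \<otimes>\<^bsub>L\<lparr>carrier := H\<rparr>\<^esub> y)"
      unfolding continuous_map_in_subtopology using top by (simp add: split_def Pi_iff)
    have "continuous_map (subtopology T H) (subtopology T H) (\<lambda>x. inv\<^bsub>L\<^esub> x)"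
      using top continuous_map_group_inv[OF L id]
      by (auto simp: continuous_map_in_subtopology simp del: topspace_subtopology)
    then show "continuous_map (subtopology T H) (subtopology T H) (\<lambda>x. inv\<^bsub>L\<lparr>carrier := H\<rparr>\<^esub> x)"
      by (rule continuous_map_eq) (simp add: top m_inv_consistent[OF H] del: topspace_subtopology)
  qed
qed

text \<open>If \<open>W\<close> meets its translate by \<open>g\<close>, the intersection is not
  meager, so it has a point outside both \<open>W - S\<close> and the translate of
  \<open>W - S\<close>. That point is in \<open>S\<close> and has the form \<open>g\<close> times an
  element of \<open>S\<close>.\<close>

lemma Pettis_difference:
  assumes L: "polish_group L T"
    and W: "openin T W" "W \<noteq> {}" and S: "S \<subseteq> carrier L" "meager_in T (W - S)"
  obtains U where "openin T U" "\<one>\<^bsub>L\<^esub> \<in> U" "\<And>g. g \<in> U \<Longrightarrow> \<exists>s\<in>S. \<exists>t\<in>S. g = s \<otimes>\<^bsub>L\<^esub> inv\<^bsub>L\<^esub> t"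
proof -
  have tg: "topological_group L T" and T': "polish_topology T"
    using L by (auto simp: polish_group_def)
  interpret group L using tg by (simp add: topological_group_def)
  have T: "topspace T = carrier L" using tg by (simp add: topological_group_def)
  have Wc: "W \<subseteq> carrier L" using W(1) openin_subset T by blast
  obtain w where w: "w \<in> W" using W by blast
  with Wc have wc: "w \<in> carrier L" by blast
  \<comment> \<open>For \<open>g\<close> in this set, \<open>g\<close> times \<open>w\<close> is a
    common point of \<open>W\<close> and its translate.\<close>
  define U where "U = {g \<in> topspace T. g \<otimes>\<^bsub>L\<^esub> w \<in> W}"
  have "continuous_map T T (\<lambda>g. g \<otimes>\<^bsub>L\<^esub> w)"
    using wc continuous_map_id[of T, unfolded id_def]
    by (intro continuous_map_group_mult[OF tg]) (simp_all add: T)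
  then have "openin T U" unfolding U_def using W(1) by (rule openin_continuous_map_preimage)
  moreover have "\<one>\<^bsub>L\<^esub> \<in> U" using w wc by (simp add: U_def T)
  moreover have "\<exists>s\<in>S. \<exists>t\<in>S. g = s \<otimes>\<^bsub>L\<^esub> inv\<^bsub>L\<^esub> t" if "g \<in> U" for g
  proof -
    have g: "g \<in> carrier L" "g \<otimes>\<^bsub>L\<^esub> w \<in> W" using that by (auto simp: U_def T)
    let ?h = "\<lambda>x. g \<otimes>\<^bsub>L\<^esub> x"
    have hom: "homeomorphic_map T T ?h" using tg g(1) by (rule homeomorphic_map_left_translation)
    have "openin T (?h ` W)"
      using homeomorphic_map_openness[OF hom, of W] W(1) Wc by (simp add: T)
    then have op: "openin T (?h ` W \<inter> W)" using W(1) by (rule openin_Int)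
    have ne: "?h ` W \<inter> W \<noteq> {}" using g w by blast
    have "meager_in T (?h ` (W - S))"
      using meager_in_homeomorphic_image[OF hom S(2)] Wc by (auto simp: T)
    then have "meager_in T (?h ` (W - S) \<union> (W - S))" using S(2) by (rule meager_in_Un)
    moreover have "\<not> meager_in T (?h ` W \<inter> W)"
      using T' not_meager_in_open[OF _ op ne] by (simp add: polish_topology_def)
    ultimately have "\<not> ?h ` W \<inter> W \<subseteq> ?h ` (W - S) \<union> (W - S)" using meager_in_subset by blast
    then obtain s t where st: "s \<in> S" "t \<in> S" "s = g \<otimes>\<^bsub>L\<^esub> t" by blast
    then have "g = s \<otimes>\<^bsub>L\<^esub> inv\<^bsub>L\<^esub> t" using g(1) S(1) by (auto simp: m_assoc)
    with st show ?thesis by blast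
  qed
  ultimately show thesis by (rule that)
qed

text \<open>The image of \<open>p\<close> is not meager, because countably many translates cover the
  group. Its quotients therefore fill a neighbourhood of the identity where \<open>f\<close> is
  bounded by \<open>2 * c\<close>; where the \<open>m\<close>-th power lies in it, the bound on
  \<open>f\<close> improves by the factor \<open>m\<close>.\<close>

lemma analytic_bounded_hom_continuous:
  fixes f :: "'a \<Rightarrow> real"
  assumes L: "polish_group L T"
    and hom: "\<And>x y. x \<in> carrier L \<Longrightarrow> y \<in> carrier L \<Longrightarrow> f (x \<otimes>\<^bsub>L\<^esub> y) = f x + f y"
    and X: "polish_topology X" and p: "continuous_map X T p"
    and bd: "\<And>x. x \<in> topspace X \<Longrightarrow> \<bar>f (p x)\<bar> \<le> c"
    and Q: "countable Q" "Q \<subseteq> carrier L"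
      "carrier L \<subseteq> (\<Union>q\<in>Q. (\<lambda>x. q \<otimes>\<^bsub>L\<^esub> x) ` p ` topspace X)"
  shows "continuous_map T euclideanreal f"
proof -
  have tg: "topological_group L T" and T': "polish_topology T"
    using L by (auto simp: polish_group_def)
  interpret group L using tg by (simp add: topological_group_def)
  have T: "topspace T = carrier L" using tg by (simp add: topological_group_def)
  let ?S = "p ` topspace X"
  have S: "?S \<subseteq> carrier L" using continuous_map_image_subset_topspace[OF p] T by simp
  have nm: "\<not> meager_in T ?S"
  proof
    assume S0: "meager_in T ?S"
    have "meager_in T (\<Union>q\<in>Q. (\<lambda>x. q \<otimes>\<^bsub>L\<^esub> x) ` ?S)"
    proof (rule meager_in_UN[OF Q(1)])
      fix q assume "q \<in> Q"
      then show "meager_in T ((\<lambda>x. q \<otimes>\<^bsub>L\<^esub> x) ` ?S)"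
        using meager_in_homeomorphic_image[OF homeomorphic_map_left_translation[OF tg, of q] S0] Q(2) S T
        by auto
    qed
    then have "meager_in T (carrier L)" using Q(3) by (rule meager_in_subset)
    moreover have "\<not> meager_in T (carrier L)"
    proof (rule not_meager_in_open)
      show "completely_metrizable_space T" using T' by (simp add: polish_topology_def)
      show "openin T (carrier L)" using openin_topspace[of T] T by simp
    qed (use one_closed in blast)
    ultimately show False by blast
  qed
  obtain W where W: "openin T W" "W \<noteq> {}" "meager_in T (W - ?S)"
    using nonmeager_continuous_image_comeager[OF X T' p nm] .
  obtain U where U: "openin T U" "\<one>\<^bsub>L\<^esub> \<in> U"
    "\<And>g. g \<in> U \<Longrightarrow> \<exists>s\<in>?S. \<exists>t\<in>?S. g = s \<otimes>\<^bsub>L\<^esub> inv\<^bsub>L\<^esub> t"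
    using Pettis_difference[OF L W(1,2) S W(3)] by blast
  have f1: "f \<one>\<^bsub>L\<^esub> = 0" using hom[of "\<one>\<^bsub>L\<^esub>" "\<one>\<^bsub>L\<^esub>"] by simp
  have finv: "f (inv\<^bsub>L\<^esub> x) = - f x" if "x \<in> carrier L" for x
    using hom[of x "inv\<^bsub>L\<^esub> x"] that by (simp add: f1)
  have bU: "\<bar>f g\<bar> \<le> 2 * c" if "g \<in> U" for g
  proof -
    obtain s t where st: "s \<in> ?S" "t \<in> ?S" "g = s \<otimes>\<^bsub>L\<^esub> inv\<^bsub>L\<^esub> t" using U(3)[OF \<open>g \<in> U\<close>] by blast
    moreover have "s \<in> carrier L" "t \<in> carrier L" using st S by auto
    ultimately have "f g = f s - f t" using hom[of s "inv\<^bsub>L\<^esub> t"] by (simp add: finv)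
    moreover have "\<bar>f s\<bar> \<le> c" "\<bar>f t\<bar> \<le> c" using st(1,2) bd by auto
    ultimately show ?thesis by linarith
  qed
  have fpow: "f (g [^]\<^bsub>L\<^esub> m) = real m * f g" if "g \<in> carrier L" for g and m :: nat
    using that by (induction m) (simp_all add: hom f1 algebra_simps)
  have cpow: "continuous_map T T (\<lambda>g. g [^]\<^bsub>L\<^esub> m)" for m :: nat
  proof (induction m)
    case 0
    show ?case by (simp add: T)
  next
    case (Suc m)
    then show ?case
      using continuous_map_group_mult[OF tg Suc continuous_map_id[of T, unfolded id_def]] by simp
  qed
  show ?thesis
    unfolding continuous_map_atin limitin_canonical_iff tendsto_iff
  proof (intro ballI allI impI)
    fix x and \<epsilon> :: real assume x: "x \<in> topspace T" and \<epsilon>: "\<epsilon> > 0"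
    obtain m where m: "2 * c < real m * \<epsilon>" using reals_Archimedean3[OF \<epsilon>] by blast
    define V where "V = {y \<in> topspace T. (inv\<^bsub>L\<^esub> x \<otimes>\<^bsub>L\<^esub> y) [^]\<^bsub>L\<^esub> m \<in> U}"
    have "continuous_map T T ((\<lambda>g. g [^]\<^bsub>L\<^esub> m) \<circ> (\<lambda>y. inv\<^bsub>L\<^esub> x \<otimes>\<^bsub>L\<^esub> y))"
    proof (rule continuous_map_compose[OF _ cpow])
      show "continuous_map T T (\<lambda>y. inv\<^bsub>L\<^esub> x \<otimes>\<^bsub>L\<^esub> y)"
        using x by (intro homeomorphic_imp_continuous_map homeomorphic_map_left_translation[OF tg])
          (simp add: T)
    qed
    then have "openin T V"
      unfolding V_def using openin_continuous_map_preimage[OF _ U(1)] by (simp add: o_def)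
    moreover have "x \<in> V" using x U(2) by (simp add: V_def T)
    moreover have "dist (f y) (f x) < \<epsilon>" if "y \<in> V" for y
    proof -
      have y: "y \<in> carrier L" "(inv\<^bsub>L\<^esub> x \<otimes>\<^bsub>L\<^esub> y) [^]\<^bsub>L\<^esub> m \<in> U" using that by (auto simp: V_def T)
      have "f (inv\<^bsub>L\<^esub> x \<otimes>\<^bsub>L\<^esub> y) = f y - f x" using x y(1) by (simp add: T hom finv)
      then have "\<bar>real m * (f y - f x)\<bar> \<le> 2 * c"
        using bU[OF y(2)] x y(1) by (simp add: fpow T)
      then have *: "real m * \<bar>f y - f x\<bar> < real m * \<epsilon>" using m by (simp add: abs_mult)
      then have "\<bar>f y - f x\<bar> < \<epsilon>" by (simp add: mult_less_cancel_left)
      then show ?thesis by (simp add: dist_real_def)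
    qed
    ultimately show "\<forall>\<^sub>F y in atin T x. dist (f y) (f x) < \<epsilon>"
      using x unfolding eventually_atin by blast
  qed
qed

section \<open>Rank one perturbations of the identity\<close>

text \<open>A transvection when \<open>u\<close> and \<open>v\<close> are orthogonal; when
  \<open>u\<close> is a multiple of \<open>v\<close>, a scaling along \<open>v\<close> that fixes
  the orthogonal complement. Both kinds are used.\<close>

definition shear :: "real^'n \<Rightarrow> real^'n \<Rightarrow> real^'n^'n" where
  "shear u v = mat 1 + (\<chi> i j. u $ i * v $ j)"

lemma shear_mult_vec: "shear u v *v x = x + (v \<bullet> x) *\<^sub>R u"
proof -
  have "(\<chi> i j. u $ i * v $ j) *v x = (v \<bullet> x) *\<^sub>R u"
    by (simp add: vec_eq_iff matrix_vector_mult_def inner_vec_def sum_distrib_left sum_distrib_right mult_ac)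
  then show ?thesis by (simp add: shear_def matrix_vector_mult_add_rdistrib)
qed

lemma mat_mult_vec: "mat c *v (x :: real^'n) = c *\<^sub>R x"
  by (simp add: vec_eq_iff matrix_vector_mult_def mat_def if_distrib[of "\<lambda>a. a * _"] cong: if_cong)

lemma det_mat: "det (mat c :: real^'n^'n) = c ^ CARD('n)"
  by (subst det_diagonal) (simp_all add: mat_def)

text \<open>An orthogonal map taking \<open>v\<close> to a multiple of an axis vector reduces this
  to a matrix that differs from the identity in one column, where Cramer's rule gives the
  determinant.\<close>

lemma det_shear:
  fixes u v :: "real^'n::finite"
  shows "det (shear u v) = 1 + u \<bullet> v"
proof -
  fix k :: "'n::finite"
  have axis: "det (shear w (axis k 1)) = 1 + w $ k" for w :: "real^'n"
  proof -
    have "shear w (axis k 1)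
        = (\<chi> i j. if j = k then (axis k 1 + w) $ i else mat 1 $ i $ j)"
      by (auto simp: vec_eq_iff shear_def mat_def axis_def)
    then show ?thesis
      using cramer_lemma[of k "mat 1 :: real^'n^'n" "axis k 1 + w"]
      by (simp only: matrix_vector_mul_lid det_I) simp
  qed
  have norm_v: "norm v = norm (norm v *\<^sub>R (axis k 1 :: real^'n))" by simp
  obtain f :: "real^'n \<Rightarrow> real^'n" where f: "orthogonal_transformation f" "f v = norm v *\<^sub>R axis k 1"
    using orthogonal_transformation_exists[OF norm_v] .
  define R where "R = matrix f"
  have R: "R *v x = f x" for x
    using f(1) by (simp add: R_def matrix_works orthogonal_transformation_linear)
  have lin: "linear f" using f(1) by (rule orthogonal_transformation_linear)
  have "R ** shear u v = shear (norm v *\<^sub>R f u) (axis k 1) ** R"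
    unfolding matrix_eq
  proof
    fix x
    have "v \<bullet> x = f v \<bullet> f x" using f(1) by (simp add: orthogonal_transformation_def)
    also have "\<dots> = norm v * (axis k 1 \<bullet> f x)" by (simp add: f(2))
    finally show "(R ** shear u v) *v x = (shear (norm v *\<^sub>R f u) (axis k 1) ** R) *v x"
      by (simp add: R shear_mult_vec linear_add[OF lin] linear_scale[OF lin] flip: matrix_vector_mul_assoc)
  qed
  then have "det R * det (shear u v) = det (shear (norm v *\<^sub>R f u) (axis k 1)) * det R"
    by (metis det_mul)
  moreover have "det R \<noteq> 0"
    using f(1) det_orthogonal_matrix[of R] by (auto simp: R_def orthogonal_transformation_matrix)
  moreover have "norm v * f u $ k = f u \<bullet> f v"
    by (simp add: f(2) inner_axis)
  moreover have "f u \<bullet> f v = u \<bullet> v" using f(1) by (simp add: orthogonal_transformation_def)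
  ultimately show ?thesis by (simp add: axis)
qed

section \<open>Matrices of determinant 1 with prescribed eigenvectors\<close>

lemma ex_other_index:
  assumes "CARD('n::finite) \<ge> 2"
  shows "\<exists>j. j \<noteq> (k :: 'n)"
proof (rule ccontr)
  assume "\<nexists>j. j \<noteq> k"
  then have "(UNIV :: 'n set) = {k}" by auto
  then have "CARD('n) = card {k}" by (rule arg_cong)
  with assms show False by simp
qed

text \<open>A second axis absorbs the compensating factor \<open>1 / c\<close>.\<close>

lemma ex_det_1_eigenvalue:
  fixes k :: "'n::finite"
  assumes "CARD('n) \<ge> 2" "c \<noteq> 0"
  obtains A :: "real^'n^'n" where "det A = 1" "A *v axis k 1 = c *\<^sub>R axis k 1"
proof -
  obtain j where j: "j \<noteq> k"
    using ex_other_index[OF assms(1)] by blast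
  let ?A = "shear ((c - 1) *\<^sub>R axis k 1) (axis k 1) ** shear ((1 / c - 1) *\<^sub>R axis j 1) (axis j 1) :: real^'n^'n"
  have "det ?A = 1"
    using assms(2) by (simp add: det_mul det_shear inner_axis_axis)
  moreover have "?A *v axis k 1 = c *\<^sub>R axis k 1"
    using j by (simp add: shear_mult_vec inner_axis_axis algebra_simps flip: matrix_vector_mul_assoc)
  ultimately show thesis by (rule that)
qed

text \<open>One Gram-Schmidt step; if \<open>u\<close> is a multiple of the axis vector, any other
  axis serves as \<open>w\<close>.\<close>

lemma ex_orthonormal_span:
  fixes u :: "real^'n"
  assumes "CARD('n) \<ge> 2" "norm u = 1"
  obtains w where "norm w = 1" "axis k 1 \<bullet> w = 0" "u = (axis k 1 \<bullet> u) *\<^sub>R axis k 1 + (w \<bullet> u) *\<^sub>R w"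
proof -
  let ?e = "axis k 1 :: real^'n"
  define v where "v = u - (?e \<bullet> u) *\<^sub>R ?e"
  have ev: "?e \<bullet> v = 0" by (simp add: v_def inner_diff_right inner_axis_axis)
  show thesis
  proof (cases "v = 0")
    case True
    obtain j where j: "j \<noteq> k"
      using ex_other_index[OF assms(1)] by blast
    have u: "u = (?e \<bullet> u) *\<^sub>R ?e" using True by (simp add: v_def)
    have "axis j 1 \<bullet> u = 0" using j by (subst u) (simp add: inner_axis_axis)
    then show thesis
      using that[of "axis j 1"] u j by (simp add: inner_axis_axis)
  next
    case False
    have "u \<bullet> v = v \<bullet> v" using ev by (simp add: v_def inner_diff_left inner_commute)
    then have "v \<bullet> u = norm v ^ 2" by (simp add: inner_commute power2_norm_eq_inner)
    then have "(v /\<^sub>R norm v) \<bullet> u = norm v"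
      using False by (simp add: power2_eq_square flip: mult.assoc)
    then have "((v /\<^sub>R norm v) \<bullet> u) *\<^sub>R (v /\<^sub>R norm v) = v"
      using False by simp
    then show thesis
      using that[of "v /\<^sub>R norm v"] False ev by (simp add: v_def)
  qed
qed

text \<open>
  The value of \<open>d\<close> makes the determinant \<open>d\<^sup>2 (1/4)\<^bsup>n-2\<^esup>\<close> equal to 1.
\<close>
lemma ex_det_1_two_eigenvectors:
  fixes u :: "real^'n" and k :: "'n::finite" and d :: real
  assumes n: "CARD('n) \<ge> 2" and u: "norm u = 1" and d: "d\<^sup>2 = 4 ^ (CARD('n) - 2)"
  obtains E :: "real^'n^'n" where "det E = 1" "(E - mat d) ** (E - mat (1 / 4)) = 0"
    "\<And>v. v \<in> {axis k 1, u} \<Longrightarrow> E *v v = d *\<^sub>R v"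
    "\<And>v x. v \<in> {axis k 1, u} \<Longrightarrow> v \<bullet> (E *v x) = d * (v \<bullet> x)"
proof -
  let ?e = "axis k 1 :: real^'n"
  obtain w where w: "norm w = 1" "?e \<bullet> w = 0" and uw: "u = (?e \<bullet> u) *\<^sub>R ?e + (w \<bullet> u) *\<^sub>R w"
    using ex_orthonormal_span[OF n u] .
  have ww: "w \<bullet> w = 1" "?e \<bullet> ?e = 1" "w \<bullet> ?e = 0"
    using w by (simp_all add: norm_eq_1 inner_axis_axis inner_commute)
  \<comment> \<open>Solves \<open>(1 / 4) * (1 + a) = d\<close>: the overall factor
    \<open>1 / 4\<close> becomes \<open>d\<close> along \<open>?e\<close> and along
    \<open>w\<close>.\<close>
  define a where "a = 4 * d - 1"
  define E where "E = mat (1 / 4) ** (shear (a *\<^sub>R ?e) ?e ** shear (a *\<^sub>R w) w)"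
  have E: "E *v x = (1 / 4) *\<^sub>R (x + (a * (?e \<bullet> x)) *\<^sub>R ?e + (a * (w \<bullet> x)) *\<^sub>R w)" for x
    using w(2) by (simp add: E_def shear_mult_vec mat_mult_vec inner_add_right algebra_simps
        flip: matrix_vector_mul_assoc)
  have span: "E *v (s *\<^sub>R ?e + t *\<^sub>R w) = d *\<^sub>R (s *\<^sub>R ?e + t *\<^sub>R w)" for s t
    using w(2) ww by (simp add: E inner_add_right a_def algebra_simps flip: scaleR_add_left)
  have e1: "?e \<bullet> (E *v x) = d * (?e \<bullet> x)" "w \<bullet> (E *v x) = d * (w \<bullet> x)" for x
    using w(2) ww by (simp_all add: E inner_add_right a_def algebra_simps)
  have "1 = (1 / 4) ^ (CARD('n) - 2) * d\<^sup>2" by (simp add: d power_divide)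
  then have "det E = 1"
  proof -
    have "det E = (1 / 4) ^ CARD('n) * (1 + a)\<^sup>2"
      using ww by (simp add: E_def det_mul det_mat det_shear power2_eq_square)
    also have "CARD('n) = 2 + (CARD('n) - 2)" using n by simp
    also have "(1 / 4) ^ (2 + (CARD('n) - 2)) * (1 + a)\<^sup>2 = (1 / 4) ^ (CARD('n) - 2) * d\<^sup>2"
      by (simp add: a_def power_add power2_eq_square)
    finally show ?thesis by (simp add: d power_divide)
  qed
  moreover have "(E - mat d) ** (E - mat (1 / 4)) = 0"
    unfolding matrix_eq
  proof
    fix x
    let ?y = "(a / 4 * (?e \<bullet> x)) *\<^sub>R ?e + (a / 4 * (w \<bullet> x)) *\<^sub>R w"
    have "(E - mat (1 / 4)) *v x = ?y"
      by (simp add: matrix_vector_mult_diff_rdistrib mat_mult_vec E algebra_simps)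
    moreover have "(E - mat d) *v ?y = 0"
      using span by (simp add: matrix_vector_mult_diff_rdistrib mat_mult_vec)
    ultimately show "((E - mat d) ** (E - mat (1 / 4))) *v x = 0 *v x"
      by (simp flip: matrix_vector_mul_assoc)
  qed
  moreover have "E *v v = d *\<^sub>R v" if "v \<in> {?e, u}" for v
    using that span[of 1 0] span[of "?e \<bullet> u" "w \<bullet> u"] uw by auto
  moreover have "v \<bullet> (E *v x) = d * (v \<bullet> x)" if "v \<in> {?e, u}" for v x
  proof -
    have "u \<bullet> (E *v x) = d * (u \<bullet> x)"
      by (subst (1 2) uw) (simp add: inner_add_left e1 algebra_simps)
    with that e1 show ?thesis by auto
  qed
  ultimately show thesis by (rule that)
qed

text \<open>The factor is \<open>2 / 2 ^ CARD('n)\<close> on the axis and \<open>2\<close> on its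
  orthogonal complement. The determinant is 1, yet neither factor is 1 in dimension at least
  2.\<close>

definition marker :: "'n::finite \<Rightarrow> real^'n^'n" where
  "marker k = mat 2 ** shear ((1 / 2 ^ CARD('n) - 1) *\<^sub>R axis k 1) (axis k 1)"

lemma marker_mult_vec:
  "marker k *v (x :: real^'n) = 2 *\<^sub>R (x + ((1 / 2 ^ CARD('n) - 1) * (axis k 1 \<bullet> x)) *\<^sub>R axis k 1)"
  by (simp add: marker_def shear_mult_vec mat_mult_vec mult.commute flip: matrix_vector_mul_assoc)

lemma det_marker: "det (marker k :: real^'n^'n) = 1"
  by (simp add: marker_def det_mul det_mat det_shear inner_axis_axis)

lemma marker_fixed_point:
  fixes x :: "real^'n"
  assumes "CARD('n) \<ge> 2" "marker k *v x = x"
  shows "x = 0"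
proof -
  let ?b = "1 / 2 ^ CARD('n) - 1 :: real"
  define t where "t = axis k 1 \<bullet> x"
  have eq: "x = (- 2 * ?b * t) *\<^sub>R axis k 1"
    using assms(2) by (simp add: marker_mult_vec t_def algebra_simps scaleR_2)
  have "t = - 2 * ?b * t"
    unfolding t_def by (subst eq) (simp add: inner_axis_axis t_def)
  then have "(1 + 2 * ?b) * t = 0" by (simp add: algebra_simps)
  \<comment> \<open>This number is \<open>2 / 2 ^ CARD('n) - 1\<close>, which vanishes only in
    dimension 1.\<close>
  moreover have "1 + 2 * ?b \<noteq> 0"
  proof
    assume "1 + 2 * ?b = 0"
    then have "(2::real) ^ CARD('n) = 2 ^ 1" by (simp add: field_simps)
    then have "CARD('n) = 1" using power_inject_exp[of "2::real" "CARD('n)" 1] by simp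
    with assms(1) show False by simp
  qed
  ultimately have "t = 0" by simp
  with eq show ?thesis by simp
qed

text \<open>\<open>marker k\<close> is scalar on the axis and on its orthogonal complement.
  \<open>F\<close> preserves the axis by the first hypothesis and the complement by the
  second.\<close>

lemma marker_commute:
  fixes F :: "real^'n^'n"
  assumes "F *v axis k 1 = d *\<^sub>R axis k 1" "\<And>x. axis k 1 \<bullet> (F *v x) = d * (axis k 1 \<bullet> x)"
  shows "F ** marker k = marker k ** F"
  unfolding matrix_eq
  by (simp add: marker_mult_vec assms matrix_vector_mult_scaleR matrix_vector_right_distrib
      mult_ac flip: matrix_vector_mul_assoc)

section \<open>Polish topologies on the affine groups\<close>

lemma closed_SO: "closed (SO :: (real^'n^'n) set)"
proof -
  have SO: "(SO :: (real^'n^'n) set) = {A. transpose A ** A = mat 1} \<inter> {A. det A = 1}"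
    by (auto simp: SO_def rotation_matrix_def orthogonal_matrix)
  have "closed {A :: real^'n^'n. transpose A ** A = mat 1}"
    unfolding transpose_def matrix_matrix_mult_def
    by (intro closed_Collect_eq continuous_intros)
  moreover have "closed {A :: real^'n^'n. det A = 1}"
    unfolding det_def by (intro closed_Collect_eq continuous_intros)
  ultimately show ?thesis unfolding SO by (rule closed_Int)
qed

lemma closed_matrix_product_eq_0:
  fixes M N :: "real^'n^'n"
  shows "closed {E. (E - M) ** (E - N) = 0}"
  unfolding matrix_matrix_mult_def by (intro closed_Collect_eq continuous_intros)

locale polish_affine_group =
  fixes G :: "(real^'n::finite^'n) set"
    and L :: "('a, 'm) monoid_scheme"
    and T :: "'a topology"
    and \<phi> :: "'a \<Rightarrow> (real^'n) \<times> (real^'n^'n)"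
  assumes card: "CARD('n) \<ge> 2"
    and G: "G \<in> {GL, SL, abs_SL, GL_plus}"
    and L: "polish_group L T"
    and iso: "\<phi> \<in> iso L (semidirect G)"
begin

section \<open>Elements of \<open>L\<close> seen through \<open>\<phi>\<close>\<close>

lemma topological_group: "topological_group L T"
  using L by (simp add: polish_group_def)

sublocale group L
  using topological_group by (simp add: topological_group_def)

lemma topspace_eq: "topspace T = carrier L"
  using topological_group by (simp add: topological_group_def)

lemma Hausdorff: "Hausdorff_space T"
  using L by (simp add: polish_group_def polish_topology_Hausdorff)

lemmas continuous_mult = continuous_map_group_mult[OF topological_group]
lemmas continuous_inv = continuous_map_group_inv[OF topological_group]

lemma continuous_const: "g \<in> carrier L \<Longrightarrow> continuous_map X T (\<lambda>x. g)"
  by (simp add: topspace_eq)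

text \<open>Choosing every witness matrix with determinant 1 treats the four groups at once.\<close>

lemma det_1_in_G: "det A = 1 \<Longrightarrow> A \<in> G"
  using G by (auto simp: GL_def SL_def abs_SL_def GL_plus_def invertible_det_nz)

lemma phi_mult:
  assumes "g \<in> carrier L" "h \<in> carrier L"
  shows "\<phi> (g \<otimes>\<^bsub>L\<^esub> h) = (fst (\<phi> g) + snd (\<phi> g) *v fst (\<phi> h), snd (\<phi> g) ** snd (\<phi> h))"
  using iso assms by (simp add: iso_def hom_def semidirect_def split_beta)

lemma phi_inj: "g \<in> carrier L \<Longrightarrow> h \<in> carrier L \<Longrightarrow> \<phi> g = \<phi> h \<Longrightarrow> g = h"
  using iso by (auto simp: iso_def bij_betw_def inj_on_def)

lemma phi_one: "\<phi> \<one>\<^bsub>L\<^esub> = (0, mat 1)"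
  using hom_one[of \<phi> L "semidirect G"] iso is_group group_semidirect[OF G]
  by (simp add: iso_def semidirect_def)

text \<open>Meaningful only for \<open>A\<close> in \<open>G\<close>, since \<open>inv_into\<close>
  is arbitrary off the image.\<close>

definition elt :: "real^'n \<Rightarrow> real^'n^'n \<Rightarrow> 'a" where
  "elt x A = inv_into (carrier L) \<phi> (x, A)"

lemma elt:
  assumes "det A = 1"
  shows "elt x A \<in> carrier L" "\<phi> (elt x A) = (x, A)"
proof -
  have "(x, A) \<in> \<phi> ` carrier L"
    using iso det_1_in_G[OF assms] by (auto simp: iso_def bij_betw_def semidirect_def)
  then show "elt x A \<in> carrier L" "\<phi> (elt x A) = (x, A)"
    unfolding elt_def by (rule inv_into_into, rule f_inv_into_f)
qed

lemma elt_trans [simp]: "elt x (mat 1) \<in> carrier L" "\<phi> (elt x (mat 1)) = (x, mat 1)"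
  by (simp_all add: elt)

lemma phi_inv:
  assumes "g \<in> carrier L" "\<phi> g = (x, mat 1)"
  shows "\<phi> (inv\<^bsub>L\<^esub> g) = (- x, mat 1)"
proof -
  have "elt (- x) (mat 1) \<otimes>\<^bsub>L\<^esub> g = \<one>\<^bsub>L\<^esub>"
    using assms by (intro phi_inj) (simp_all add: phi_mult phi_one)
  then have "inv\<^bsub>L\<^esub> g = elt (- x) (mat 1)"
    using assms(1) by (intro inv_equality) simp_all
  then show ?thesis by simp
qed

text \<open>The translation part of \<open>g\<close> cancels, so conjugating translations exposes
  the matrix of \<open>g\<close> through group operations alone.\<close>

lemma phi_conj:
  assumes "g \<in> carrier L" "h \<in> carrier L" "\<phi> h = (y, mat 1)"
  shows "\<phi> (g \<otimes>\<^bsub>L\<^esub> h \<otimes>\<^bsub>L\<^esub> inv\<^bsub>L\<^esub> g) = (snd (\<phi> g) *v y, mat 1)"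
proof -
  have "g \<otimes>\<^bsub>L\<^esub> h = elt (snd (\<phi> g) *v y) (mat 1) \<otimes>\<^bsub>L\<^esub> g"
    using assms by (intro phi_inj) (simp_all add: phi_mult)
  then have "g \<otimes>\<^bsub>L\<^esub> h \<otimes>\<^bsub>L\<^esub> inv\<^bsub>L\<^esub> g = elt (snd (\<phi> g) *v y) (mat 1)"
    using assms(1) by (simp add: m_assoc)
  then show ?thesis by simp
qed

text \<open>
  The double centralizer of a translation is closed by its form, and \<open>mem_line\<close> identifies it.
\<close>
definition line :: "'n \<Rightarrow> 'a set" where
  "line k = {g \<in> carrier L. \<forall>c\<in>carrier L.
     c \<otimes>\<^bsub>L\<^esub> elt (axis k 1) (mat 1) = elt (axis k 1) (mat 1) \<otimes>\<^bsub>L\<^esub> c \<longrightarrow> c \<otimes>\<^bsub>L\<^esub> g = g \<otimes>\<^bsub>L\<^esub> c}"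

text \<open>The centralizer of the axis translation consists of the elements whose matrix fixes the
  axis vector. The translations in it force the matrix of \<open>g\<close> to be the identity; the
  transvections in it kill the other coordinates of \<open>g\<close>.\<close>

lemma mem_line: "g \<in> line k \<longleftrightarrow> g \<in> carrier L \<and> (\<exists>t. \<phi> g = (t *\<^sub>R axis k 1, mat 1))"
proof
  assume g: "g \<in> line k"
  then have gc: "g \<in> carrier L" by (simp add: line_def)
  have comm: "c \<otimes>\<^bsub>L\<^esub> g = g \<otimes>\<^bsub>L\<^esub> c" if "c \<in> carrier L" "snd (\<phi> c) *v axis k 1 = axis k 1" for c
  proof -
    have "c \<otimes>\<^bsub>L\<^esub> elt (axis k 1) (mat 1) = elt (axis k 1) (mat 1) \<otimes>\<^bsub>L\<^esub> c"
      using that by (intro phi_inj) (simp_all add: phi_mult add.commute)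
    with g that(1) show ?thesis by (simp add: line_def)
  qed
  have "snd (\<phi> g) *v y = y" for y
    using arg_cong[OF comm[of "elt y (mat 1)"], of \<phi>] gc by (simp add: phi_mult)
  then have A: "snd (\<phi> g) = mat 1" by (simp add: matrix_eq)
  have "fst (\<phi> g) $ j = 0" if j: "j \<noteq> k" for j
  proof -
    let ?B = "shear (axis k 1) (axis j 1) :: real^'n^'n"
    have d: "det ?B = 1" using j by (simp add: det_shear inner_axis_axis)
    have eq: "elt 0 ?B \<otimes>\<^bsub>L\<^esub> g = g \<otimes>\<^bsub>L\<^esub> elt 0 ?B"
      using j by (intro comm) (simp_all add: elt[OF d] shear_mult_vec inner_axis_axis)
    have "\<phi> (elt 0 ?B \<otimes>\<^bsub>L\<^esub> g) = \<phi> (g \<otimes>\<^bsub>L\<^esub> elt 0 ?B)" by (simp only: eq)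
    then have "?B *v fst (\<phi> g) = fst (\<phi> g)"
      unfolding phi_mult[OF elt(1)[OF d] gc] phi_mult[OF gc elt(1)[OF d]] elt(2)[OF d] by simp
    then show ?thesis
      by (simp add: shear_mult_vec inner_axis' axis_eq_0_iff)
  qed
  then have "fst (\<phi> g) = (fst (\<phi> g) $ k) *\<^sub>R axis k 1"
    by (auto simp: vec_eq_iff axis_def)
  with gc A show "g \<in> carrier L \<and> (\<exists>t. \<phi> g = (t *\<^sub>R axis k 1, mat 1))"
    by (metis prod.collapse)
next
  assume "g \<in> carrier L \<and> (\<exists>t. \<phi> g = (t *\<^sub>R axis k 1, mat 1))"
  then obtain t where g: "g \<in> carrier L" "\<phi> g = (t *\<^sub>R axis k 1, mat 1)" by blast
  have "c \<otimes>\<^bsub>L\<^esub> g = g \<otimes>\<^bsub>L\<^esub> c"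
    if c: "c \<in> carrier L" "c \<otimes>\<^bsub>L\<^esub> elt (axis k 1) (mat 1) = elt (axis k 1) (mat 1) \<otimes>\<^bsub>L\<^esub> c" for c
  proof -
    have "snd (\<phi> c) *v axis k 1 = axis k 1"
      using arg_cong[OF c(2), of \<phi>] c(1) by (simp add: phi_mult add.commute)
    with g c(1) show ?thesis
      by (intro phi_inj) (simp_all add: phi_mult matrix_vector_mult_scaleR add.commute)
  qed
  with g(1) show "g \<in> line k" by (simp add: line_def)
qed

lemma closedin_line: "closedin T (line k)"
proof -
  let ?e = "elt (axis k 1) (mat 1)"
  let ?C = "{c \<in> carrier L. c \<otimes>\<^bsub>L\<^esub> ?e = ?e \<otimes>\<^bsub>L\<^esub> c}"
  let ?F = "\<lambda>c. {g \<in> topspace T. c \<otimes>\<^bsub>L\<^esub> g = g \<otimes>\<^bsub>L\<^esub> c}"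
  have "closedin T (\<Inter>c\<in>?C. ?F c)"
  proof (rule closedin_INT)
    show "?C \<noteq> {}" by (auto intro!: exI[of _ ?e])
    have id: "continuous_map T T (\<lambda>x. x)" using continuous_map_id[of T] by (simp add: id_def)
    show "closedin T (?F c)" if "c \<in> ?C" for c
      using that
      by (intro closedin_continuous_maps_eq[OF Hausdorff] continuous_mult continuous_const id) auto
  qed
  moreover have "(\<Inter>c\<in>?C. ?F c) = line k"
    using elt_trans(1)[of "axis k 1"] by (auto simp: line_def topspace_eq)
  ultimately show ?thesis by simp
qed

lemma subgroup_line: "subgroup (line k) L"
proof (rule subgroupI)
  show "line k \<subseteq> carrier L" by (auto simp: mem_line)
  have "elt 0 (mat 1) \<in> line k" by (simp add: mem_line exI[of _ 0])
  then show "line k \<noteq> {}" by blast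
next
  fix g assume "g \<in> line k"
  then obtain t where g: "g \<in> carrier L" "\<phi> g = (t *\<^sub>R axis k 1, mat 1)" by (auto simp: mem_line)
  then show "inv\<^bsub>L\<^esub> g \<in> line k"
    by (auto simp: mem_line phi_inv intro!: exI[of _ "- t"])
  fix h assume "h \<in> line k"
  then obtain s where h: "h \<in> carrier L" "\<phi> h = (s *\<^sub>R axis k 1, mat 1)" by (auto simp: mem_line)
  with g show "g \<otimes>\<^bsub>L\<^esub> h \<in> line k"
    by (auto simp: mem_line phi_mult intro!: exI[of _ "t + s"] scaleR_add_left[symmetric])
qed

section \<open>Continuity of the line coordinates and of the matrix part\<close>

lemma phi_invertible: "g \<in> carrier L \<Longrightarrow> invertible (snd (\<phi> g))"
proof -
  assume "g \<in> carrier L"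
  then have "\<phi> g \<in> UNIV \<times> G"
    using iso by (auto simp: iso_def hom_def semidirect_def)
  then have "snd (\<phi> g) \<in> G" by (cases "\<phi> g") simp
  then show ?thesis
    using G by (auto simp: GL_def SL_def abs_SL_def GL_plus_def invertible_det_nz)
qed

text \<open>Order is recovered algebraically: nonzero scalings have positive squares, and two such
  squares with sum 1 lie between 0 and 1. This yields the bounded analytic set that
  \<open>analytic_bounded_hom_continuous\<close> requires.\<close>

lemma continuous_map_line_coordinate:
  "continuous_map (subtopology T (line k)) euclideanreal (\<lambda>g. fst (\<phi> g) $ k)"
proof -
  let ?e = "elt (axis k 1) (mat 1)"
  \<comment> \<open>\<open>r g\<close> translates by the image of the axis vector under the matrix
    of \<open>g\<close>, and \<open>q g\<close> by its image under the squared matrix. Thus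
    \<open>r g\<close> in \<open>line k\<close> means an eigenvector, and \<open>q g\<close> then
    carries the squared eigenvalue.\<close>
  define r where "r g = g \<otimes>\<^bsub>L\<^esub> ?e \<otimes>\<^bsub>L\<^esub> inv\<^bsub>L\<^esub> g" for g
  define q where "q g = g \<otimes>\<^bsub>L\<^esub> g \<otimes>\<^bsub>L\<^esub> ?e \<otimes>\<^bsub>L\<^esub> inv\<^bsub>L\<^esub> (g \<otimes>\<^bsub>L\<^esub> g)" for g
  have r: "r g \<in> carrier L" "\<phi> (r g) = (snd (\<phi> g) *v axis k 1, mat 1)"
    and q: "q g \<in> carrier L" "\<phi> (q g) = (snd (\<phi> g) *v (snd (\<phi> g) *v axis k 1), mat 1)"
    if "g \<in> carrier L" for g
    using that phi_conj[OF that elt_trans] phi_conj[OF m_closed[OF that that] elt_trans]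
    unfolding r_def q_def phi_mult[OF that that] by (simp_all add: matrix_vector_mul_assoc)
  let ?P = "prod_topology T T"
  have cont: "continuous_map X T (\<lambda>x. r (f x))" "continuous_map X T (\<lambda>x. q (f x))"
    if "continuous_map X T f" for X :: "'z topology" and f
    unfolding r_def q_def
    by (intro continuous_mult continuous_inv continuous_const that elt_trans)+
  have pr: "continuous_map ?P T fst" "continuous_map ?P T snd"
    by (rule continuous_map_fst, rule continuous_map_snd)
  define Z where "Z = {z \<in> topspace ?P. r (fst z) \<in> line k} \<inter> {z \<in> topspace ?P. r (snd z) \<in> line k}
    \<inter> {z \<in> topspace ?P. q (fst z) \<otimes>\<^bsub>L\<^esub> q (snd z) = ?e}"
  have "closedin ?P Z"
    unfolding Z_def
    by (intro closedin_Int closedin_continuous_map_preimage[OF _ closedin_line] cont pr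
        closedin_continuous_maps_eq[OF Hausdorff] continuous_mult continuous_const elt_trans)
  then have polish_Z: "polish_topology (subtopology ?P Z)"
    using L by (intro polish_topology_closedin polish_topology_prod) (auto simp: polish_group_def)
  have topZ: "topspace (subtopology ?P Z) = Z" by (auto simp: Z_def)
  have memZ: "\<exists>t\<in>{0<..<1}. \<phi> (q g) = (t *\<^sub>R axis k 1, mat 1)" if "(g, h) \<in> Z" for g h
  proof -
    have g: "g \<in> carrier L" "h \<in> carrier L" "r g \<in> line k" "r h \<in> line k" "q g \<otimes>\<^bsub>L\<^esub> q h = ?e"
      using that by (auto simp: Z_def topspace_eq)
    obtain s where "\<phi> (r g) = (s *\<^sub>R axis k 1, mat 1)" using g(3) by (auto simp: mem_line)
    then have s: "snd (\<phi> g) *v axis k 1 = s *\<^sub>R axis k 1" using r(2)[OF g(1)] by simp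
    obtain t where "\<phi> (r h) = (t *\<^sub>R axis k 1, mat 1)" using g(4) by (auto simp: mem_line)
    then have t: "snd (\<phi> h) *v axis k 1 = t *\<^sub>R axis k 1" using r(2)[OF g(2)] by simp
    \<comment> \<open>Invertibility excludes the eigenvalue 0, so both squares are positive and
      hence below 1.\<close>
    have nz: "c \<noteq> 0" if "A *v axis k 1 = c *\<^sub>R axis k 1" "invertible A" for A :: "real^'n^'n" and c
    proof
      assume "c = 0"
      with that(1) have "A *v axis k 1 = 0" by simp
      then have "axis k (1::real) = 0"
        using that(2) by (metis matrix_vector_mult_0_right invertible_def matrix_vector_mul_assoc matrix_vector_mul_lid)
      then show False by (simp add: axis_eq_0_iff)
    qed
    have qg: "\<phi> (q g) = ((s\<^sup>2) *\<^sub>R axis k 1, mat 1)" "\<phi> (q h) = ((t\<^sup>2) *\<^sub>R axis k 1, mat 1)"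
      using q(2)[OF g(1)] q(2)[OF g(2)] s t by (simp_all add: matrix_vector_mult_scaleR power2_eq_square)
    then have "(s\<^sup>2) *\<^sub>R axis k 1 + (t\<^sup>2) *\<^sub>R axis k 1 = (axis k 1 :: real^'n)"
      using arg_cong[OF g(5), of \<phi>] q(1)[OF g(1)] q(1)[OF g(2)] by (simp add: phi_mult)
    then have "((s\<^sup>2) *\<^sub>R axis k 1 + (t\<^sup>2) *\<^sub>R axis k 1) $ k = (axis k 1 :: real^'n) $ k" by simp
    then have "s\<^sup>2 + t\<^sup>2 = 1" by simp
    moreover have "s\<^sup>2 > 0" "t\<^sup>2 > 0" using nz s t phi_invertible g(1,2) by auto
    ultimately have "0 < s\<^sup>2" "s\<^sup>2 < 1" by linarith+
    then show ?thesis using qg by (intro bexI[of _ "s\<^sup>2"]) auto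
  qed
  let ?p = "\<lambda>z. q (fst z)"
  have p: "continuous_map (subtopology ?P Z) (subtopology T (line k)) ?p"
    unfolding continuous_map_in_subtopology topZ
  proof
    show "continuous_map (subtopology ?P Z) T ?p"
      by (intro cont continuous_map_from_subtopology pr)
    show "?p \<in> Z \<rightarrow> line k"
    proof
      fix z assume "z \<in> Z"
      then obtain g h where z: "z = (g, h)" "g \<in> carrier L" "(g, h) \<in> Z"
        by (auto simp: Z_def topspace_eq)
      from memZ[OF z(3)] obtain t where "\<phi> (q g) = (t *\<^sub>R axis k 1, mat 1)" ..
      with z q(1)[OF z(2)] show "?p z \<in> line k" by (auto simp: mem_line)
    qed
  qed
  have surj: "\<exists>z\<in>Z. \<phi> (?p z) = (t *\<^sub>R axis k 1, mat 1)" if t: "0 < t" "t < 1" for t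
  proof -
    \<comment> \<open>\<open>q\<close> squares eigenvalues, so the roots of \<open>t\<close> and
      \<open>1 - t\<close> are prescribed.\<close>
    have "sqrt t \<noteq> 0" "sqrt (1 - t) \<noteq> 0" using t by auto
    then obtain A B :: "real^'n^'n" where A: "det A = 1" "A *v axis k 1 = sqrt t *\<^sub>R axis k 1"
      and B: "det B = 1" "B *v axis k 1 = sqrt (1 - t) *\<^sub>R axis k 1"
      using ex_det_1_eigenvalue[OF card] by metis
    let ?g = "elt 0 A" and ?h = "elt 0 B"
    have c: "?g \<in> carrier L" "?h \<in> carrier L" using A B by (simp_all add: elt)
    have qg: "\<phi> (q ?g) = (t *\<^sub>R axis k 1, mat 1)" "\<phi> (q ?h) = ((1 - t) *\<^sub>R axis k 1, mat 1)"
      using q(2)[OF c(1)] q(2)[OF c(2)] A B t by (simp_all add: elt matrix_vector_mult_scaleR)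
    have "q ?g \<otimes>\<^bsub>L\<^esub> q ?h = ?e"
      using q(1)[OF c(1)] q(1)[OF c(2)]
      by (intro phi_inj) (simp_all add: phi_mult qg flip: scaleR_add_left)
    moreover have "r ?g \<in> line k" "r ?h \<in> line k"
      using r[OF c(1)] r[OF c(2)] A B by (auto simp: mem_line elt)
    ultimately have "(?g, ?h) \<in> Z" using c by (simp add: Z_def topspace_eq)
    with qg show ?thesis by (intro bexI[of _ "(?g, ?h)"]) auto
  qed
  let ?L = "L\<lparr>carrier := line k\<rparr>"
  \<comment> \<open>Every real is a rational plus a number strictly between 0 and 1, so these
    translates of the segment cover the line.\<close>
  let ?Q = "(\<lambda>s. elt (s *\<^sub>R axis k 1) (mat 1)) ` \<rat>"
  show ?thesis
  proof (rule analytic_bounded_hom_continuous[OF _ _ polish_Z p])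
    show "polish_group ?L (subtopology T (line k))"
      using L topological_group_subgroup[OF topological_group subgroup_line]
        polish_topology_closedin[OF _ closedin_line] by (auto simp: polish_group_def)
    show "fst (\<phi> (x \<otimes>\<^bsub>?L\<^esub> y)) $ k = fst (\<phi> x) $ k + fst (\<phi> y) $ k"
      if "x \<in> carrier ?L" "y \<in> carrier ?L" for x y
      using that by (auto simp: mem_line phi_mult)
    show "\<bar>fst (\<phi> (?p z)) $ k\<bar> \<le> 1" if "z \<in> topspace (subtopology ?P Z)" for z
    proof -
      have "(fst z, snd z) \<in> Z" using that topZ by simp
      from memZ[OF this] show ?thesis by auto
    qed
    show "countable ?Q" by (intro countable_image countable_rat)
    show "?Q \<subseteq> carrier ?L" by (auto simp: mem_line)
    show "carrier ?L \<subseteq> (\<Union>c\<in>?Q. (\<lambda>x. c \<otimes>\<^bsub>?L\<^esub> x) ` ?p ` topspace (subtopology ?P Z))"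
    proof
      fix g assume "g \<in> carrier ?L"
      then obtain t where g: "g \<in> carrier L" "\<phi> g = (t *\<^sub>R axis k 1, mat 1)" by (auto simp: mem_line)
      obtain s where s: "s \<in> \<rat>" "t - 1 < s" "s < t" using Rats_dense_in_real[of "t - 1" t] by auto
      have "0 < t - s" "t - s < 1" using s by simp_all
      from surj[OF this] obtain z where z: "z \<in> Z" "\<phi> (?p z) = ((t - s) *\<^sub>R axis k 1, mat 1)" ..
      have "fst z \<in> carrier L" using z(1) by (auto simp: Z_def topspace_eq)
      then have zc: "?p z \<in> carrier L" by (rule q(1))
      have "g = elt (s *\<^sub>R axis k 1) (mat 1) \<otimes>\<^bsub>L\<^esub> ?p z"
        using g zc by (intro phi_inj) (simp_all add: phi_mult z(2) flip: scaleR_add_left)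
      moreover have "?p z \<in> ?p ` topspace (subtopology ?P Z)" using z(1) unfolding topZ by (rule imageI)
      ultimately have "g \<in> (\<lambda>x. elt (s *\<^sub>R axis k 1) (mat 1) \<otimes>\<^bsub>?L\<^esub> x) ` ?p ` topspace (subtopology ?P Z)"
        by (intro image_eqI[of _ _ "?p z"]) simp_all
      with s(1) show "g \<in> (\<Union>c\<in>?Q. (\<lambda>x. c \<otimes>\<^bsub>?L\<^esub> x) ` ?p ` topspace (subtopology ?P Z))"
        by blast
    qed
  qed
qed

text \<open>Matrices converge entrywise, and each entry is the coordinate of a commutator that lies
  on a line.\<close>

lemma continuous_map_linear_part: "continuous_map T euclidean (\<lambda>g. snd (\<phi> g))"
proof -
  have entry: "continuous_map T euclideanreal (\<lambda>g. snd (\<phi> g) $ i $ k)" for i k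
  proof -
    obtain j where j: "j \<noteq> i" using ex_other_index[OF card] by blast
    let ?e = "elt (axis k 1) (mat 1)" and ?m = "elt 0 (shear (axis j 1) (axis i 1))"
    have m: "?m \<in> carrier L" "\<phi> ?m = (0, shear (axis j 1) (axis i 1))"
      using j by (simp_all add: elt det_shear inner_axis_axis)
    define h where "h g = g \<otimes>\<^bsub>L\<^esub> ?e \<otimes>\<^bsub>L\<^esub> inv\<^bsub>L\<^esub> g" for g
    \<comment> \<open>The commutator of \<open>?m\<close> with the translation by column
      \<open>k\<close> of the matrix. As \<open>?m\<close> adds coordinate \<open>i\<close> to
      coordinate \<open>j\<close>, only the entry at \<open>i\<close>, \<open>k\<close> survives,
      placed along axis \<open>j\<close>.\<close>
    define w where "w g = ?m \<otimes>\<^bsub>L\<^esub> h g \<otimes>\<^bsub>L\<^esub> inv\<^bsub>L\<^esub> ?m \<otimes>\<^bsub>L\<^esub> inv\<^bsub>L\<^esub> h g" for g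
    have w: "w g \<in> carrier L" "\<phi> (w g) = ((snd (\<phi> g) $ i $ k) *\<^sub>R axis j 1, mat 1)"
      if g: "g \<in> carrier L" for g
    proof -
      have h: "h g \<in> carrier L" "\<phi> (h g) = (snd (\<phi> g) *v axis k 1, mat 1)"
        using g by (simp_all add: h_def phi_conj)
      then show "w g \<in> carrier L" using m by (simp add: w_def)
      have "axis i 1 \<bullet> (snd (\<phi> g) *v axis k 1) = snd (\<phi> g) $ i $ k"
        by (simp add: inner_axis' matrix_vector_mult_basis column_def)
      then show "\<phi> (w g) = ((snd (\<phi> g) $ i $ k) *\<^sub>R axis j 1, mat 1)"
        using h m by (simp add: w_def phi_mult[of _ "inv\<^bsub>L\<^esub> h g"] phi_inv[OF h] phi_conj[OF m(1) h] shear_mult_vec)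
    qed
    have "continuous_map T (subtopology T (line j)) w"
      unfolding continuous_map_in_subtopology
    proof
      have id: "continuous_map T T (\<lambda>x. x)" using continuous_map_id[of T] by (simp add: id_def)
      show "continuous_map T T w"
        unfolding w_def h_def using m(1)
        by (intro continuous_mult continuous_inv continuous_const id elt_trans)
      show "w \<in> topspace T \<rightarrow> line j" using w by (auto simp: topspace_eq mem_line)
    qed
    then have "continuous_map T euclideanreal ((\<lambda>g. fst (\<phi> g) $ j) \<circ> w)"
      using continuous_map_line_coordinate by (rule continuous_map_compose)
    then show ?thesis
      by (rule continuous_map_eq) (simp add: w topspace_eq)
  qed
  show ?thesis
    unfolding continuous_map_atin limitin_canonical_iff
  proof
    fix g assume "g \<in> topspace T"
    then show "((\<lambda>g. snd (\<phi> g)) \<longlongrightarrow> snd (\<phi> g)) (atin T g)"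
      using entry unfolding continuous_map_atin limitin_canonical_iff
      by (intro vec_tendstoI) auto
  qed
qed

section \<open>The rotation subgroup and its analyticity\<close>

lemma subgroup_SO: "subgroup {x \<in> carrier L. \<phi> x \<in> embed_matrices SO} L"
proof (rule subgroupI)
  have mem: "\<phi> x \<in> embed_matrices SO \<longleftrightarrow> fst (\<phi> x) = 0 \<and> rotation_matrix (snd (\<phi> x))" for x
    by (cases "\<phi> x") (auto simp: embed_matrices_def SO_def)
  have rot_mult: "rotation_matrix (A ** B)" if "rotation_matrix A" "rotation_matrix B" for A B :: "real^'n^'n"
    using that by (simp add: rotation_matrix_def orthogonal_matrix_mul det_mul)
  have rot_one: "rotation_matrix (mat 1 :: real^'n^'n)"
    by (simp add: rotation_matrix_def orthogonal_matrix_id)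
  show "{x \<in> carrier L. \<phi> x \<in> embed_matrices SO} \<subseteq> carrier L" by blast
  have "\<one>\<^bsub>L\<^esub> \<in> {x \<in> carrier L. \<phi> x \<in> embed_matrices SO}"
    by (simp add: mem phi_one rot_one)
  then show "{x \<in> carrier L. \<phi> x \<in> embed_matrices SO} \<noteq> {}" by blast
  fix x assume "x \<in> {x \<in> carrier L. \<phi> x \<in> embed_matrices SO}"
  then have x: "x \<in> carrier L" "fst (\<phi> x) = 0" "rotation_matrix (snd (\<phi> x))" by (auto simp: mem)
  let ?A = "snd (\<phi> x)"
  have A: "?A ** transpose ?A = mat 1" "det ?A = 1" "rotation_matrix (transpose ?A)"
    using x(3) by (auto simp: rotation_matrix_def orthogonal_matrix_def)
  have d: "det (transpose ?A) = 1" using A(2) by simp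
  have "elt 0 (transpose ?A) \<otimes>\<^bsub>L\<^esub> x = \<one>\<^bsub>L\<^esub>"
    using x by (intro phi_inj)
      (simp_all add: phi_mult phi_one elt[OF d] rotation_matrix_def orthogonal_matrix_def)
  then have "inv\<^bsub>L\<^esub> x = elt 0 (transpose ?A)"
    using x(1) elt(1)[OF d] by (intro inv_equality)
  then show "inv\<^bsub>L\<^esub> x \<in> {x \<in> carrier L. \<phi> x \<in> embed_matrices SO}"
    using x(1) A(3) by (simp add: mem elt[OF d])
  fix y assume "y \<in> {x \<in> carrier L. \<phi> x \<in> embed_matrices SO}"
  then show "x \<otimes>\<^bsub>L\<^esub> y \<in> {x \<in> carrier L. \<phi> x \<in> embed_matrices SO}"
    using x by (auto simp: mem phi_mult rot_mult)
qed

text \<open>The set is the projection of a closed set of triples \<open>(h, k, m)\<close> in a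
  Polish product, where \<open>m\<close> is the conjugate of \<open>k\<close> by the inverse of
  \<open>h\<close>.\<close>

lemma analytic_SO: "analytic_in T {x \<in> carrier L. \<phi> x \<in> embed_matrices SO}"
proof -
  fix i :: 'n
  \<comment> \<open>The sign matters in dimension 2, where the positive root would be 1.\<close>
  define d :: real where "d = - (2 ^ (CARD('n) - 2))"
  have d: "d\<^sup>2 = 4 ^ (CARD('n) - 2)"
    by (simp add: d_def power2_eq_square flip: power_mult_distrib)
  have d1: "d \<noteq> 1"
  proof -
    have "(0::real) < 2 ^ (CARD('n) - 2)" by simp
    then show ?thesis unfolding d_def by linarith
  qed
  let ?D = "elt 0 (marker i)"
  have D: "?D \<in> carrier L" "\<phi> ?D = (0, marker i)" by (simp_all add: elt det_marker)
  \<comment> \<open>An element commuting with \<open>?D\<close> sends the origin to a fixed point of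
    \<open>marker i\<close>, which can only be the origin.\<close>
  have fixes_origin: "fst (\<phi> k) = 0" if "k \<in> carrier L" "k \<otimes>\<^bsub>L\<^esub> ?D = ?D \<otimes>\<^bsub>L\<^esub> k" for k
  proof -
    have "\<phi> (k \<otimes>\<^bsub>L\<^esub> ?D) = \<phi> (?D \<otimes>\<^bsub>L\<^esub> k)" by (simp only: that(2))
    then have "marker i *v fst (\<phi> k) = fst (\<phi> k)"
      unfolding phi_mult[OF that(1) D(1)] phi_mult[OF D(1) that(1)] D(2) by simp
    then show ?thesis by (rule marker_fixed_point[OF card])
  qed
  let ?P = "prod_topology T (prod_topology T T)"
  have pr: "continuous_map ?P T (\<lambda>z. fst z)" "continuous_map ?P T (\<lambda>z. fst (snd z))"
    "continuous_map ?P T (\<lambda>z. snd (snd z))"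
  proof -
    show "continuous_map ?P T (\<lambda>z. fst z)" by (rule continuous_map_fst)
    have s: "continuous_map ?P (prod_topology T T) snd" by (rule continuous_map_snd)
    show "continuous_map ?P T (\<lambda>z. fst (snd z))" "continuous_map ?P T (\<lambda>z. snd (snd z))"
      using continuous_map_compose[OF s continuous_map_fst] continuous_map_compose[OF s continuous_map_snd]
      by (simp_all add: o_def)
  qed
  have lin: "continuous_map ?P euclidean (\<lambda>z. snd (\<phi> (f z)))" if "continuous_map ?P T f" for f
    using continuous_map_compose[OF that continuous_map_linear_part] by (simp add: o_def)
  define K where "K = {E :: real^'n^'n. (E - mat d) ** (E - mat (1 / 4)) = 0}"
  define Z where "Z = {z \<in> topspace ?P. snd (\<phi> (fst z)) \<in> SO}
    \<inter> {z \<in> topspace ?P. snd (\<phi> (fst (snd z))) \<in> K}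
    \<inter> {z \<in> topspace ?P. fst (snd z) \<otimes>\<^bsub>L\<^esub> ?D = ?D \<otimes>\<^bsub>L\<^esub> fst (snd z)}
    \<inter> {z \<in> topspace ?P. snd (snd z) \<otimes>\<^bsub>L\<^esub> ?D = ?D \<otimes>\<^bsub>L\<^esub> snd (snd z)}
    \<inter> {z \<in> topspace ?P. fst (snd z) \<otimes>\<^bsub>L\<^esub> fst z = fst z \<otimes>\<^bsub>L\<^esub> snd (snd z)}"
  have cl: "closedin euclidean (SO :: (real^'n^'n) set)" "closedin euclidean K"
    using closed_SO closed_matrix_product_eq_0 by (auto simp: K_def simp flip: closed_closedin)
  have "closedin ?P Z"
    unfolding Z_def
    by (intro closedin_Int closedin_continuous_map_preimage[OF _ cl(1)]
        closedin_continuous_map_preimage[OF _ cl(2)] lin pr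
        closedin_continuous_maps_eq[OF Hausdorff] continuous_mult continuous_const D(1))
  then have "polish_topology (subtopology ?P Z)"
    using L by (intro polish_topology_closedin polish_topology_prod) (auto simp: polish_group_def)
  moreover have "continuous_map (subtopology ?P Z) T (\<lambda>z. fst z)"
    by (intro continuous_map_from_subtopology pr)
  moreover have "(\<lambda>z. fst z) ` topspace (subtopology ?P Z) = {x \<in> carrier L. \<phi> x \<in> embed_matrices SO}"
  proof -
    have topZ: "topspace (subtopology ?P Z) = Z" by (auto simp: Z_def)
    have "h \<in> carrier L \<and> \<phi> h \<in> embed_matrices SO" if "(h, k, m) \<in> Z" for h k m
    proof -
      have c: "h \<in> carrier L" "k \<in> carrier L" "m \<in> carrier L" and A: "snd (\<phi> h) \<in> SO"
        and K: "snd (\<phi> k) \<in> K" and k: "k \<otimes>\<^bsub>L\<^esub> ?D = ?D \<otimes>\<^bsub>L\<^esub> k" and m: "m \<otimes>\<^bsub>L\<^esub> ?D = ?D \<otimes>\<^bsub>L\<^esub> m"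
        and kh: "k \<otimes>\<^bsub>L\<^esub> h = h \<otimes>\<^bsub>L\<^esub> m"
        using that by (auto simp: Z_def topspace_eq)
      let ?x = "fst (\<phi> h)" and ?E = "snd (\<phi> k)"
      have "\<phi> (k \<otimes>\<^bsub>L\<^esub> h) = \<phi> (h \<otimes>\<^bsub>L\<^esub> m)" by (simp only: kh)
      then have E: "?E *v ?x = ?x"
        unfolding phi_mult[OF c(2,1)] phi_mult[OF c(1,3)] fixes_origin[OF c(2) k] fixes_origin[OF c(3) m]
        by simp
      \<comment> \<open>Since \<open>?E\<close> fixes \<open>?x\<close>, each factor of the
        quadratic acts on \<open>?x\<close> as a scalar. The product of the scalars is
        \<open>(3 / 4) * (1 - d)\<close>, which is not 0.\<close>
      have eq: "(?E - mat c) *v ?x = (1 - c) *\<^sub>R ?x" for c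
        by (simp add: matrix_vector_mult_diff_rdistrib mat_mult_vec E scaleR_left_diff_distrib)
      have "(?E - mat d) *v ((?E - mat (1 / 4)) *v ?x) = 0"
        using K by (simp add: K_def matrix_vector_mul_assoc)
      then have "(1 - 1 / 4) *\<^sub>R (1 - d) *\<^sub>R ?x = 0"
        unfolding eq matrix_vector_mult_scaleR .
      then have "?x = 0" using d1 by simp
      with c(1) A show ?thesis by (cases "\<phi> h") (auto simp: embed_matrices_def)
    qed
    moreover have "\<exists>k m. (h, k, m) \<in> Z" if h: "h \<in> carrier L" "\<phi> h \<in> embed_matrices SO" for h
    proof -
      obtain A where A: "\<phi> h = (0, A)" "rotation_matrix A" "A \<in> SO"
        using h(2) by (auto simp: embed_matrices_def SO_def)
      have orth: "transpose A ** A = mat 1" "A ** transpose A = mat 1" "det A = 1"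
        using A(2) by (auto simp: rotation_matrix_def orthogonal_matrix_def)
      have adj: "x \<bullet> (transpose A *v y) = (A *v x) \<bullet> y" for x y
        by (metis dot_lmul_matrix inner_commute transpose_matrix_vector)
      have iso: "(A *v x) \<bullet> (A *v y) = x \<bullet> y" for x y
        by (simp add: matrix_vector_mul_assoc orth flip: adj)
      let ?e = "axis i 1 :: real^'n"
      have "norm (A *v ?e) = 1" by (simp add: norm_eq_1 iso inner_axis_axis)
      then obtain E where E: "det E = 1" "(E - mat d) ** (E - mat (1 / 4)) = 0"
        "\<And>v. v \<in> {?e, A *v ?e} \<Longrightarrow> E *v v = d *\<^sub>R v"
        "\<And>v x. v \<in> {?e, A *v ?e} \<Longrightarrow> v \<bullet> (E *v x) = d * (v \<bullet> x)"
        using ex_det_1_two_eigenvectors[OF card _ d] by (metis (no_types, lifting))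
      \<comment> \<open>The transpose inverts the rotation \<open>A\<close>, so this is the matrix
        of the conjugate of \<open>elt 0 E\<close> by the inverse of \<open>h\<close>.\<close>
      let ?F = "transpose A ** E ** A"
      have F: "det ?F = 1" by (simp add: det_mul orth E(1))
      have "E ** marker i = marker i ** E"
        using E(3,4) by (intro marker_commute[where d = d]) auto
      moreover have "?F ** marker i = marker i ** ?F"
      \<comment> \<open>Conjugation carries the eigenvector \<open>A *v ?e\<close> of
        \<open>E\<close> back to \<open>?e\<close>. For this reason \<open>E\<close> was chosen with
        both vectors as eigenvectors.\<close>
      proof (rule marker_commute)
        have "?F *v ?e = transpose A *v (E *v (A *v ?e))" by (simp flip: matrix_vector_mul_assoc)
        also have "\<dots> = d *\<^sub>R (transpose A *v (A *v ?e))"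
          using E(3) by (simp add: matrix_vector_mult_scaleR)
        also have "\<dots> = d *\<^sub>R ?e" by (simp add: matrix_vector_mul_assoc orth)
        finally show "?F *v ?e = d *\<^sub>R ?e" .
        fix x
        have "?e \<bullet> (?F *v x) = ?e \<bullet> (transpose A *v (E *v (A *v x)))" by (simp flip: matrix_vector_mul_assoc)
        also have "\<dots> = d * ((A *v ?e) \<bullet> (A *v x))" unfolding adj by (rule E(4)) simp
        finally show "?e \<bullet> (?F *v x) = d * (?e \<bullet> x)" by (simp add: iso)
      qed
      moreover have "A ** ?F = E ** A" by (simp add: matrix_mul_assoc orth)
      ultimately have "elt 0 E \<otimes>\<^bsub>L\<^esub> ?D = ?D \<otimes>\<^bsub>L\<^esub> elt 0 E" "elt 0 ?F \<otimes>\<^bsub>L\<^esub> ?D = ?D \<otimes>\<^bsub>L\<^esub> elt 0 ?F"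
        "elt 0 E \<otimes>\<^bsub>L\<^esub> h = h \<otimes>\<^bsub>L\<^esub> elt 0 ?F"
        using D h(1) A(1) elt[OF E(1)] elt[OF F] by (auto intro!: phi_inj simp: phi_mult)
      then have "(h, elt 0 E, elt 0 ?F) \<in> Z"
        using h(1) A elt[OF E(1)] elt[OF F] E(2) by (simp add: Z_def topspace_eq K_def)
      then show ?thesis by blast
    qed
    ultimately show ?thesis unfolding topZ by force
  qed
  ultimately show ?thesis by (rule analytic_inI)
qed

end

theorem corollary27:
  fixes G :: "(real^'n^'n) set"
    and L :: "('a, 'm) monoid_scheme"
    and T :: "'a topology"
    and \<phi> :: "'a \<Rightarrow> (real^'n) \<times> (real^'n^'n)"
  assumes "CARD('n) \<ge> 2"
    and "G \<in> {GL, SL, abs_SL, GL_plus}"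
    and "polish_group L T"
    and "\<phi> \<in> iso L (semidirect G)"
  shows "analytic_subgroup {x \<in> carrier L. \<phi> x \<in> embed_matrices SO} L T"
proof -
  interpret polish_affine_group G L T \<phi>
    using assms by unfold_locales
  show ?thesis
    unfolding analytic_subgroup_def using subgroup_SO analytic_SO by simp
qed

end
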